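(* Let $n,k\geq 1$. The maps $\Theta$ and $\Theta'$ restrict to mutually inverse bijections between $\overline{\mathcal{X}}_n(k)$ and $\overline{\mathcal{Y}}_n(k)$. Moreover, for every $(F,S)\in\overline{\mathcal{X}}_n(k)$, writing $S_1=S\cap\mathrm{Oint}^*(F)$ and $S_2=S\cap\mathrm{Si}^*(F)$, one has $\Theta(F,S)=(\Phi_{S_1}(F),S_2)$ and $\mathrm{lleaf}(\Phi_{S_1}(F))-\mathrm{si}(\Phi_{S_1}(F))=\mathrm{lleaf}(F)-\mathrm{si}(F)+|S_1|$.
   Context: Trees: all trees are ordered (plane) rooted trees; the level of a node is its distance from the root (root at level 0); a leaf is a node with no children. An even $k$-ary tree is an ordered tree in which every node on an even level has exactly $k$ children. A pruned even $k$-ary tree is obtained from an even $k$-ary tree by deleting, for every even-level node all of whose children are leaves, all those children. An increasing pruned even $k$-ary tree on a set $M$ of positive integers is a pruned even $k$-ary tree whose nodes on even levels are labeled bijectively by $M$ (odd-level nodes unlabeled) such that labels increase along every path from the root downward and, for each node, the labels of its children increase from left to right. $\mathcal{F}_n(k)$ is the set of sequences $F=(T_1,\dots,T_m)$ of such trees whose label sets partition $[n]$ and whose root labels increase left to right. A labeled node is a leaf if it has no children and internal otherwise; $\mathrm{lleaf}(F)$ is the number of labeled leaves. A singleton is a one-node tree; $\mathrm{si}(F)$ is the number of singletons, $\mathrm{Si}(F)$ the set of their labels, and $\mathrm{Si}^*(F)$ is $\mathrm{Si}(F)$ minus the label of $T_m$ if $T_m$ is a singleton (otherwise $\mathrm{Si}^*(F)=\mathrm{Si}(F)$).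 For a labeled node $v$, its grand parent is the labeled node $u$ such that a child of $u$ is the parent of $v$. A labeled non-root node is old if its label is the greatest among all grand children of its grand parent, and young otherwise; roots are neither. $\mathrm{Oint}(F)$ is the set of labels of old internal nodes of $F$, $\mathrm{Yleaf}(F)$ the set of labels of young leaves. $\mathrm{Oint}^*(F)$ is $\mathrm{Oint}(F)$ minus the label $x$ if the root of $T_m$ has a grand child labeled $x$ that is an old internal node (otherwise $\mathrm{Oint}^*(F)=\mathrm{Oint}(F)$). $\Phi_x$ on a tree $T$ (for a label $x$ of node $v$): (i) if $v$ is old internal, with grand parent $u$, children $\mu_1..\mu_k$ of $u$ and children $\nu_1..\nu_k$ of $v$ (left to right), delete each $\nu_j$ and attach the subtrees rooted at children of $\nu_j$ to $\mu_j$, ordering children of $\mu_j$ increasingly; (ii) if $v$ is a young leaf, with grand parent $u$ and children $\mu_1..\mu_k$ of $u$, let $F_j$ be the subtrees of $\mu_j$ whose root labels exceed $x$; attach $k$ new unlabeled children $\nu_1..\nu_k$ to $v$ and move the subtrees in $F_j$ to $\nu_j$, ordering increasingly; (iii) otherwise $\Phi_x(T)=T$. $\Phi_S(T)$ is the composition of $\Phi_x$, $x\in S$; for a forest, $\Phi_S(F)=(\Phi_{S_1}(T_1),\dots,\Phi_{S_m}(T_m))$ with $S_i$ the elements of $S$ labeling nodes of $T_i$ (for $S\subseteq\mathrm{Oint}(F)$ or $S\subseteq\mathrm{Yleaf}(F)$). Removable leaves of $F=(T_1,\dots,T_m)$: an old leaf $u$ of $T_i$ is removable if $u$ is a grand child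 of the root of $T_i$ and the only leaf among the grand children of that root, the first $k-1$ children of the root of $T_i$ are leaves, and (if $i<m$) the label of $u$ is smaller than the root label of $T_{i+1}$. A young leaf $u\in T_m$ with label $x$ is removable if $u$ is a grand child of the root of $T_m$ and the first $k-1$ children of the root of $\Phi_x(T_m)$ are leaves. $\mathrm{rleaf}(F)$ is the total number of removable old and removable young leaves. $\overline{\mathcal{F}}_n(k)$ is the set of $F\in\mathcal{F}_n(k)$ whose rightmost tree is a singleton or has the first $k-1$ children of its root being leaves; $\overline{\mathcal{F}}^*_n(k)=\{F\in\overline{\mathcal{F}}_n(k): F\text{ has no young leaves},\ \mathrm{rleaf}(F)=0\}$. $\overline{\mathcal{X}}_n(k)=\{(F,S):F\in\overline{\mathcal{F}}^*_n(k),\ S\subseteq\mathrm{Oint}^*(F)\cup\mathrm{Si}^*(F)\}$ and $\overline{\mathcal{Y}}_n(k)=\{(F,S):F\in\overline{\mathcal{F}}_n(k),\ \mathrm{rleaf}(F)=0,\ S\subseteq\mathrm{Si}^*(F)\}$. $\Theta(F,S)=(\Phi_{S\cap\mathrm{Oint}(F)}(F),\,S\cap\mathrm{Si}^*(F))$ for $F$ without young leaves and $S\subseteq\mathrm{Oint}(F)\cup\mathrm{Si}^*(F)$; $\Theta'(F,S_1)=(\Phi_{\mathrm{Yleaf}(F)}(F),\,S_1\cup\mathrm{Yleaf}(F))$ for $S_1\subseteq\mathrm{Si}^*(F)$. *)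

theory Defs
  imports Main
begin

text \<open>
  Plane trees whose even-level nodes carry labels. An odd-level node is represented by the list of
  its (labeled) children, so \<open>kids v\<close> is the list of the odd-level children of the labeled node \<open>v\<close>,
  an odd-level node is a leaf iff it is the empty list, and \<open>v\<close> is a leaf iff \<open>kids v = []\<close>.
\<close>

datatype tree = Node (label: nat) (kids: "tree list list")

definition gchildren :: "tree \<Rightarrow> tree list" where
  "gchildren u = concat (kids u)"

text \<open>The labeled nodes, each given as the subtree hanging from it.\<close>

fun nodes :: "tree \<Rightarrow> tree list" where
  "nodes (Node x cs) = Node x cs # concat (map (\<lambda>c. concat (map nodes c)) cs)"

definition labels :: "tree \<Rightarrow> nat list" where
  "labels T = map label (nodes T)"

definition leaf :: "tree \<Rightarrow> bool" where
  "leaf v \<longleftrightarrow> kids v = []"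

definition even_kary :: "nat \<Rightarrow> tree \<Rightarrow> bool" where
  "even_kary k T \<longleftrightarrow> (\<forall>u\<in>set (nodes T). length (kids u) = k)"

fun prune :: "tree \<Rightarrow> tree" where
  "prune (Node x cs) = Node x (if \<forall>c\<in>set cs. c = [] then [] else map (map prune) cs)"

definition pruned_even_kary :: "nat \<Rightarrow> tree \<Rightarrow> bool" where
  "pruned_even_kary k T \<longleftrightarrow> (\<exists>T'. even_kary k T' \<and> T = prune T')"

definition increasing :: "tree \<Rightarrow> bool" where
  "increasing T \<longleftrightarrow>
     (\<forall>u\<in>set (nodes T). (\<forall>v\<in>set (gchildren u). label u < label v) \<and>
                        (\<forall>c\<in>set (kids u). sorted_wrt (<) (map label c)))"

definition inc_tree :: "nat \<Rightarrow> nat set \<Rightarrow> tree \<Rightarrow> bool" where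
  "inc_tree k M T \<longleftrightarrow>
     pruned_even_kary k T \<and> increasing T \<and> distinct (labels T) \<and> set (labels T) = M"

type_synonym forest = "tree list"

definition fnodes :: "forest \<Rightarrow> tree list" where
  "fnodes F = concat (map nodes F)"

definition forests :: "nat \<Rightarrow> nat \<Rightarrow> forest set" where
  "forests n k = {F. (\<forall>T\<in>set F. \<exists>M. inc_tree k M T) \<and>
     distinct (concat (map labels F)) \<and> set (concat (map labels F)) = {1..n} \<and>
     sorted_wrt (<) (map label F)}"

definition lleaf :: "forest \<Rightarrow> nat" where
  "lleaf F = length (filter leaf (fnodes F))"

text \<open>A tree is a singleton iff its root is a leaf.\<close>

definition si :: "forest \<Rightarrow> nat" where
  "si F = length (filter leaf F)"

definition Si :: "forest \<Rightarrow> nat set" where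
  "Si F = {label T | T. T \<in> set F \<and> leaf T}"

definition Si_star :: "forest \<Rightarrow> nat set" where
  "Si_star F = (if leaf (last F) then Si F - {label (last F)} else Si F)"

text \<open>\<open>old u v\<close> and \<open>young u v\<close>: the labeled node \<open>v\<close>, with grand parent \<open>u\<close>, is old (young).\<close>

definition old :: "tree \<Rightarrow> tree \<Rightarrow> bool" where
  "old u v \<longleftrightarrow> v \<in> set (gchildren u) \<and> (\<forall>w\<in>set (gchildren u). label w \<le> label v)"

definition young :: "tree \<Rightarrow> tree \<Rightarrow> bool" where
  "young u v \<longleftrightarrow> v \<in> set (gchildren u) \<and> \<not> old u v"

definition Oint :: "forest \<Rightarrow> nat set" where
  "Oint F = {label v | u v. u \<in> set (fnodes F) \<and> old u v \<and> \<not> leaf v}"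

definition Yleaf :: "forest \<Rightarrow> nat set" where
  "Yleaf F = {label v | u v. u \<in> set (fnodes F) \<and> young u v \<and> leaf v}"

definition Oint_star :: "forest \<Rightarrow> nat set" where
  "Oint_star F = Oint F - {label v | v. old (last F) v \<and> \<not> leaf v}"

text \<open>
  \<open>pull x ms ns\<close> and \<open>push x ms\<close> give the new children of the grand parent \<open>u\<close> of the node labeled
  \<open>x\<close>, where \<open>ms\<close> are the old children of \<open>u\<close> and \<open>ns\<close> the children of the node labeled \<open>x\<close>.
\<close>

definition pull :: "nat \<Rightarrow> tree list list \<Rightarrow> tree list list \<Rightarrow> tree list list" where
  "pull x ms ns =
     map2 (\<lambda>m n. sort_key label (map (\<lambda>t. if label t = x then Node x [] else t) m @ n)) ms ns"

definition push :: "nat \<Rightarrow> tree list list \<Rightarrow> tree list list" where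
  "push x ms =
     map (\<lambda>m. map (\<lambda>t. if label t = x
                        then Node x (map (\<lambda>m'. sort_key label (filter (\<lambda>s. x < label s) m')) ms)
                        else t)
                   (filter (\<lambda>s. \<not> x < label s) m)) ms"

fun Phi1 :: "nat \<Rightarrow> tree \<Rightarrow> tree" where
  "Phi1 x (Node y cs) =
     (case find (\<lambda>v. label v = x) (concat cs) of
        None \<Rightarrow> Node y (map (map (Phi1 x)) cs)
      | Some v \<Rightarrow>
          if old (Node y cs) v \<and> \<not> leaf v then Node y (pull x cs (kids v))
          else if young (Node y cs) v \<and> leaf v then Node y (push x cs)
          else Node y cs)"

text \<open>
  The maps \<open>Phi1 x\<close> commute on increasing pruned even \<open>k\<close>-ary trees, so the order of composition
  is immaterial; increasing order of the labels is used.
\<close>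

definition Phi_tree :: "nat set \<Rightarrow> tree \<Rightarrow> tree" where
  "Phi_tree S T = fold Phi1 (sorted_list_of_set S) T"

definition Phi :: "nat set \<Rightarrow> forest \<Rightarrow> forest" where
  "Phi S F = map (\<lambda>T. Phi_tree (S \<inter> set (labels T)) T) F"

definition first_leaves :: "nat \<Rightarrow> tree \<Rightarrow> bool" where
  "first_leaves k T \<longleftrightarrow> (\<forall>c\<in>set (take (k - 1) (kids T)). c = [])"

definition removable_old :: "nat \<Rightarrow> forest \<Rightarrow> nat set" where
  "removable_old k F = {label u | u i. i < length F \<and> old (F ! i) u \<and> leaf u \<and>
     (\<forall>w\<in>set (gchildren (F ! i)). leaf w \<longrightarrow> w = u) \<and>
     first_leaves k (F ! i) \<and>
     (Suc i < length F \<longrightarrow> label u < label (F ! Suc i))}"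

definition removable_young :: "nat \<Rightarrow> forest \<Rightarrow> nat set" where
  "removable_young k F = {label u | u. young (last F) u \<and> leaf u \<and>
     first_leaves k (Phi1 (label u) (last F))}"

definition rleaf :: "nat \<Rightarrow> forest \<Rightarrow> nat" where
  "rleaf k F = card (removable_old k F) + card (removable_young k F)"

definition forests_bar :: "nat \<Rightarrow> nat \<Rightarrow> forest set" where
  "forests_bar n k = {F \<in> forests n k. leaf (last F) \<or> first_leaves k (last F)}"

definition forests_bar_star :: "nat \<Rightarrow> nat \<Rightarrow> forest set" where
  "forests_bar_star n k = {F \<in> forests_bar n k. Yleaf F = {} \<and> rleaf k F = 0}"

definition X_bar :: "nat \<Rightarrow> nat \<Rightarrow> (forest \<times> nat set) set" where
  "X_bar n k = {(F, S). F \<in> forests_bar_star n k \<and> S \<subseteq> Oint_star F \<union> Si_star F}"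

definition Y_bar :: "nat \<Rightarrow> nat \<Rightarrow> (forest \<times> nat set) set" where
  "Y_bar n k = {(F, S). F \<in> forests_bar n k \<and> rleaf k F = 0 \<and> S \<subseteq> Si_star F}"

definition Theta :: "forest \<times> nat set \<Rightarrow> forest \<times> nat set" where
  "Theta = (\<lambda>(F, S). (Phi (S \<inter> Oint F) F, S \<inter> Si_star F))"

definition Theta' :: "forest \<times> nat set \<Rightarrow> forest \<times> nat set" where
  "Theta' = (\<lambda>(F, S). (Phi (Yleaf F) F, S \<union> Yleaf F))"

end

theory Submission
  imports Defs "HOL-Library.Multiset"
begin

text \<open>
  A forest is encoded by its set of edges \<open>(u, j, v)\<close>: the node labeled \<open>v\<close> is a child of the
  \<open>j\<close>-th child of the node labeled \<open>u\<close>. Together with the list of root labels this set determines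
  the forest, and \<open>Phi1 x\<close> only redirects first components: either every edge leaving \<open>x\<close> is moved
  up to the grand parent of \<open>x\<close>, or the edges from that grand parent to labels greater than \<open>x\<close>
  are moved down to \<open>x\<close>. On edge sets one sees directly that these moves are mutually inverse,
  commute, and exchange old internal nodes with young leaves. Removable old leaves are not affected
  by moving up a set of old internal nodes: a removable old leaf is the unique leaf two levels below
  its root, whereas a moved node becomes a young leaf there.
\<close>

section \<open>Flips of edge sets\<close>

text \<open>The starred sets exist to protect the last root. In both directions the flipped labels
  therefore avoid the grand children of the last root and every edge leaving this root stays fixed.
  This preserves the condition on its first \<open>k - 1\<close> children, and it lets no removable
  young leaf appear.

  A second obstacle is the order of composition: \<open>Phi\<close> runs through increasing labels
  in both directions, whereas undoing a composition reverses the order. Commutation is proved for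
  upward moves only; downward moves inherit it, since after they are made all their labels are old
  internal.

  An edge set forgets the order among siblings and the children lists that are empty. Both can be
  restored: siblings increase strictly, and an internal node has exactly \<open>k\<close>
  children.\<close>

type_synonym edge_set = "(nat \<times> nat \<times> nat) set"

definition gch :: "edge_set \<Rightarrow> nat \<Rightarrow> nat set" where
  "gch E u = {v. \<exists>j. (u, j, v) \<in> E}"

definition inner :: "edge_set \<Rightarrow> nat set" where
  "inner E = {u. \<exists>j v. (u, j, v) \<in> E}"

text \<open>The counterpart of \<open>Oint\<close> for edge sets, as \<open>young_outer\<close> is
  that of \<open>Yleaf\<close>; \<open>Oint_eq\<close> and \<open>Yleaf_eq\<close> identify them on
  proper forests.\<close>

definition old_inner :: "edge_set \<Rightarrow> nat set" where
  "old_inner E = {v. \<exists>u. v \<in> gch E u \<and> (\<forall>w\<in>gch E u. w \<le> v) \<and> v \<in> inner E}"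

definition young_outer :: "edge_set \<Rightarrow> nat set" where
  "young_outer E = {v. \<exists>u. v \<in> gch E u \<and> (\<exists>w\<in>gch E u. v < w) \<and> v \<notin> inner E}"

text \<open>What the flips use about an increasing forest: labels grow along edges, and a label has
  at most one incoming edge, hence one grand parent and one position below it. Roots are simply
  labels without an incoming edge.\<close>

definition arbo :: "edge_set \<Rightarrow> bool" where
  "arbo E \<longleftrightarrow> (\<forall>u j v. (u, j, v) \<in> E \<longrightarrow> u < v) \<and>
     (\<forall>u j v u' j'. (u, j, v) \<in> E \<longrightarrow> (u', j', v) \<in> E \<longrightarrow> u = u' \<and> j = j')"

text \<open>The index \<open>j\<close> is kept: this is the merging of the \<open>j\<close>-th child
  of \<open>x\<close> into the \<open>j\<close>-th child of its grand parent. The first disjunct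
  drops the edges leaving \<open>x\<close>, the second re-adds them one grand parent higher.\<close>

definition pullE :: "nat \<Rightarrow> edge_set \<Rightarrow> edge_set" where
  "pullE x E = {(u, j, v). u \<noteq> x \<and> (u, j, v) \<in> E \<or> x \<in> gch E u \<and> (x, j, v) \<in> E}"

definition pushE :: "nat \<Rightarrow> edge_set \<Rightarrow> edge_set" where
  "pushE x E = {(u, j, v). (u, j, v) \<in> E \<and> \<not> (x \<in> gch E u \<and> x < v) \<or>
     u = x \<and> x < v \<and> (\<exists>g. x \<in> gch E g \<and> (g, j, v) \<in> E)}"

definition flipE :: "nat \<Rightarrow> edge_set \<Rightarrow> edge_set" where
  "flipE x E = (if x \<in> old_inner E then pullE x E
     else if x \<in> young_outer E then pushE x E else E)"

lemma arbo_less: "arbo E \<Longrightarrow> v \<in> gch E u \<Longrightarrow> u < v"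
  by (auto simp: arbo_def gch_def)

lemma arbo_fun: "arbo E \<Longrightarrow> v \<in> gch E u \<Longrightarrow> v \<in> gch E u' \<Longrightarrow> u = u'"
  by (auto simp: arbo_def gch_def)

lemma arbo_index: "arbo E \<Longrightarrow> (u, j, v) \<in> E \<Longrightarrow> (u', j', v) \<in> E \<Longrightarrow> u = u' \<and> j = j'"
  unfolding arbo_def by blast

lemma inner_iff_gch: "u \<in> inner E \<longleftrightarrow> gch E u \<noteq> {}"
  by (auto simp: inner_def gch_def)

lemma gchI: "(u, j, v) \<in> E \<Longrightarrow> v \<in> gch E u"
  by (auto simp: gch_def)

lemma young_outer_not_old_inner: "x \<in> young_outer E \<Longrightarrow> x \<notin> old_inner E"
  by (auto simp: young_outer_def old_inner_def)

lemma gch_pullE: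
  "gch (pullE x E) u = (if u = x then {} else gch E u) \<union> (if x \<in> gch E u then gch E x else {})"
  by (auto simp: gch_def pullE_def)

lemma gch_pushE:
  "gch (pushE x E) u = {v \<in> gch E u. \<not> (x \<in> gch E u \<and> x < v)} \<union>
     (if u = x then {v. x < v \<and> (\<exists>g. x \<in> gch E g \<and> v \<in> gch E g)} else {})"
  by (auto simp: gch_def pushE_def)

section \<open>Moving the grand children of an old internal node up to its grand parent\<close>

context
  fixes E x assumes A: "arbo E" and x: "x \<in> old_inner E"
begin

lemma arbo_pullE: "arbo (pullE x E)"
  unfolding arbo_def
proof (intro conjI allI impI)
  fix u j v assume "(u, j, v) \<in> pullE x E"
  then show "u < v" using arbo_less[OF A] by (auto simp: pullE_def dest: gchI intro: less_trans)
next
  fix u j v u' j' assume "(u, j, v) \<in> pullE x E" "(u', j', v) \<in> pullE x E"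
  then show "u = u'" "j = j'" using arbo_index[OF A] arbo_fun[OF A] by (auto simp: pullE_def)
qed

private lemma obtain_gp:
  obtains g where "x \<in> gch E g" "\<And>h. x \<in> gch E h \<longleftrightarrow> h = g" "\<And>w. w \<in> gch E g \<Longrightarrow> w \<le> x"
    "gch E x \<noteq> {}" "g < x" "x \<notin> gch E x"
  using x arbo_fun[OF A] arbo_less[OF A] unfolding old_inner_def inner_iff_gch by blast

text \<open>Only \<open>x\<close> loses its edges. The one node that gains edges, the grand parent
  \<open>g\<close>, was already internal, since \<open>x\<close> itself hangs below it.\<close>

lemma inner_pullE: "inner (pullE x E) = inner E - {x}"
proof -
  obtain g where g: "x \<in> gch E g" "\<And>h. x \<in> gch E h \<longleftrightarrow> h = g" "\<And>w. w \<in> gch E g \<Longrightarrow> w \<le> x"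
    "gch E x \<noteq> {}" "g < x" "x \<notin> gch E x" by (rule obtain_gp) (rule that)
  have "u \<in> inner (pullE x E) \<longleftrightarrow> u \<in> inner E - {x}" for u
    using g(1,4-6) by (cases "u = g") (auto simp: inner_iff_gch gch_pullE)
  then show ?thesis by blast
qed

text \<open>Everything below \<open>g\<close> is at most \<open>x\<close>, and everything below
  \<open>x\<close> exceeds \<open>x\<close>. After the move the greatest grand child of
  \<open>g\<close> is thus the former greatest grand child of \<open>x\<close>: it stays old under
  its new grand parent, and \<open>x\<close> alone ceases to be old internal.\<close>

lemma old_inner_pullE: "old_inner (pullE x E) = old_inner E - {x}"
proof -
  obtain g where g: "x \<in> gch E g" "\<And>h. x \<in> gch E h \<longleftrightarrow> h = g" "\<And>w. w \<in> gch E g \<Longrightarrow> w \<le> x"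
    "gch E x \<noteq> {}" "g < x" "x \<notin> gch E x" by (rule obtain_gp) (rule that)
  have xl: "x < w" if "w \<in> gch E x" for w using arbo_less[OF A that] .
  have "y \<in> old_inner (pullE x E)" if y: "y \<in> old_inner E" "y \<noteq> x" for y
  proof -
    obtain h where h: "y \<in> gch E h" "\<forall>w\<in>gch E h. w \<le> y" "y \<in> inner E"
      using y by (auto simp: old_inner_def)
    have "h \<noteq> g" using h g y(2) by (meson le_antisym)
    show ?thesis
    proof (cases "h = x")
      case True
      then have "\<forall>w\<in>gch E g. w \<le> y" using g(3) xl h(1) by (meson less_imp_le order_trans)
      then show ?thesis unfolding old_inner_def inner_pullE gch_pullE using h y(2) True g
        by (auto intro!: exI[of _ g])
    next
      case False
      then show ?thesis unfolding old_inner_def inner_pullE gch_pullE using h y(2) \<open>h \<noteq> g\<close> g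
        by (auto intro!: exI[of _ h])
    qed
  qed
  moreover have "y \<in> old_inner E - {x}" if y: "y \<in> old_inner (pullE x E)" for y
  proof -
    obtain h where h: "y \<in> gch (pullE x E) h" "\<forall>w\<in>gch (pullE x E) h. w \<le> y" "y \<in> inner E" "y \<noteq> x"
      using y by (auto simp: old_inner_def inner_pullE)
    show ?thesis
    proof (cases "h = g")
      case True
      \<comment> \<open>Any former grand child of \<open>x\<close> bounds \<open>y\<close> from
        below by a number above \<open>x\<close>, so \<open>y\<close> cannot have been below
        \<open>g\<close> and must come from \<open>x\<close>.\<close>
      obtain w where "w \<in> gch E x" using g by blast
      then have "w \<le> y" using h(2) True g by (auto simp: gch_pullE)
      then have "y \<in> gch E x" using h(1) True g xl[OF \<open>w \<in> gch E x\<close>]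
        by (auto simp: gch_pullE split: if_splits dest: g(3))
      then show ?thesis using h True g by (auto simp: old_inner_def gch_pullE)
    next
      case False
      then show ?thesis using h g by (auto simp: old_inner_def gch_pullE split: if_splits)
    qed
  qed
  ultimately show ?thesis by blast
qed

text \<open>The leaf \<open>x\<close> is now overtaken by its former grand children. No other status
  changes: an old companion of \<open>x\<close> was already below \<open>x\<close>, and a label
  coming from \<open>x\<close> is overtaken only by another label coming from
  \<open>x\<close>.\<close>

lemma young_outer_pullE: "young_outer (pullE x E) = insert x (young_outer E)"
proof -
  obtain g where g: "x \<in> gch E g" "\<And>h. x \<in> gch E h \<longleftrightarrow> h = g" "\<And>w. w \<in> gch E g \<Longrightarrow> w \<le> x"
    "gch E x \<noteq> {}" "g < x" "x \<notin> gch E x" by (rule obtain_gp) (rule that)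
  have xl: "x < w" if "w \<in> gch E x" for w using arbo_less[OF A that] .
  have "y \<in> young_outer (pullE x E)" if y: "y \<in> young_outer E" for y
  proof -
    obtain h w where h: "y \<in> gch E h" "w \<in> gch E h" "y < w" "y \<notin> inner E"
      using y by (auto simp: young_outer_def)
    show ?thesis
    proof (cases "h = x")
      case True
      then show ?thesis unfolding young_outer_def inner_pullE gch_pullE using h g
        by (auto intro!: exI[of _ g])
    next
      case False
      then show ?thesis unfolding young_outer_def inner_pullE gch_pullE using h g
        by (auto intro!: exI[of _ h])
    qed
  qed
  moreover have "x \<in> young_outer (pullE x E)"
    using g xl unfolding young_outer_def inner_pullE gch_pullE by (auto intro!: exI[of _ g])
  moreover have "y \<in> young_outer E" if y: "y \<in> young_outer (pullE x E)" "y \<noteq> x" for y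
  proof -
    obtain h w where h: "y \<in> gch (pullE x E) h" "w \<in> gch (pullE x E) h" "y < w" "y \<notin> inner E"
      using y by (auto simp: young_outer_def inner_pullE)
    show ?thesis
    proof (cases "h = g")
      case True
      show ?thesis
      proof (cases "y \<in> gch E x")
        case True
        then have "w \<notin> gch E g" using h(3) xl g(3) by force
        then have "w \<in> gch E x" using h(2) \<open>h = g\<close> by (auto simp: gch_pullE split: if_splits)
        then show ?thesis using h True by (auto simp: young_outer_def)
      next
        case False
        then have "y \<in> gch E g" using h True by (auto simp: gch_pullE split: if_splits)
        moreover from this have "y < x" using g(3) y(2) by (simp add: le_neq_implies_less)
        ultimately show ?thesis using h g by (auto simp: young_outer_def)
      qed
    next
      case False
      then show ?thesis using h g by (auto simp: young_outer_def gch_pullE split: if_splits)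
    qed
  qed
  ultimately show ?thesis by blast
qed

text \<open>Since \<open>x\<close> was the greatest grand child of \<open>g\<close>, the labels
  above \<open>x\<close> that are below \<open>g\<close> after the move are exactly those that came
  from \<open>x\<close>; the push sends precisely these back.\<close>

lemma pushE_pullE: "pushE x (pullE x E) = E"
proof -
  obtain g where g: "x \<in> gch E g" "\<And>h. x \<in> gch E h \<longleftrightarrow> h = g" "\<And>w. w \<in> gch E g \<Longrightarrow> w \<le> x"
    "gch E x \<noteq> {}" "g < x" "x \<notin> gch E x" by (rule obtain_gp) (rule that)
  have xl: "x < w" if "(x, j, w) \<in> E" for w j using arbo_less[OF A gchI[OF that]] .
  have gl: "w \<le> x" if "(g, j, w) \<in> E" for w j using g(3)[OF gchI[OF that]] .
  have 1: "x \<in> gch (pullE x E) u \<longleftrightarrow> u = g" for u using g by (auto simp: gch_pullE)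
  have "(u, j, v) \<in> pushE x (pullE x E) \<longleftrightarrow> (u, j, v) \<in> E" for u j v
    unfolding pushE_def 1 using g xl gl by (force simp: pullE_def)
  then show ?thesis by auto
qed

end

section \<open>Moving the greater companions of a young leaf below it\<close>

context
  fixes E x assumes A: "arbo E" and x: "x \<in> young_outer E"
begin

private lemma obtain_gp':
  obtains g b where "x \<in> gch E g" "\<And>h. x \<in> gch E h \<longleftrightarrow> h = g" "b \<in> gch E g" "x < b"
    "gch E x = {}" "g < x"
  using x arbo_fun[OF A] arbo_less[OF A] unfolding young_outer_def inner_iff_gch by blast

lemma arbo_pushE: "arbo (pushE x E)"
  unfolding arbo_def
proof (intro conjI allI impI)
  fix u j v assume "(u, j, v) \<in> pushE x E"
  then show "u < v" using arbo_less[OF A] by (fastforce simp: pushE_def dest: gchI)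
next
  fix u j v u' j' assume "(u, j, v) \<in> pushE x E" "(u', j', v) \<in> pushE x E"
  then show "u = u'" "j = j'" using arbo_index[OF A] arbo_fun[OF A] unfolding pushE_def
    by (auto; blast)+
qed

lemma inner_pushE: "inner (pushE x E) = insert x (inner E)"
proof -
  obtain g b where g: "x \<in> gch E g" "\<And>h. x \<in> gch E h \<longleftrightarrow> h = g" "b \<in> gch E g" "x < b"
    "gch E x = {}" "g < x" by (rule obtain_gp') (rule that)
  have "u \<in> inner (pushE x E) \<longleftrightarrow> u \<in> insert x (inner E)" for u
  proof (cases "u = g")
    case True
    then have "x \<in> gch (pushE x E) u" using g(1) by (auto simp: gch_pushE)
    then show ?thesis using g(1) True by (auto simp: inner_iff_gch)
  next
    case False
    then show ?thesis using g(3-6) by (auto simp: inner_iff_gch gch_pushE g(2))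
  qed
  then show ?thesis by blast
qed

text \<open>The labels that overtook \<open>x\<close> have all gone below it, and there was at least
  one, \<open>b\<close>, which makes \<open>x\<close> internal.\<close>

lemma old_inner_pushE: "x \<in> old_inner (pushE x E)"
proof -
  obtain g b where g: "x \<in> gch E g" "\<And>h. x \<in> gch E h \<longleftrightarrow> h = g" "b \<in> gch E g" "x < b"
    "gch E x = {}" "g < x" by (rule obtain_gp') (rule that)
  then show ?thesis unfolding old_inner_def inner_pushE gch_pushE by (auto intro!: exI[of _ g])
qed

text \<open>As \<open>x\<close> was a leaf, the edges leaving it after the push are exactly the
  moved ones, so pulling returns these and nothing else.\<close>

lemma pullE_pushE: "pullE x (pushE x E) = E"
proof -
  obtain g b where g: "x \<in> gch E g" "\<And>h. x \<in> gch E h \<longleftrightarrow> h = g" "b \<in> gch E g" "x < b"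
    "gch E x = {}" "g < x" by (rule obtain_gp') (rule that)
  have 1: "x \<in> gch (pushE x E) u \<longleftrightarrow> u = g" for u using g by (auto simp: gch_pushE)
  have 2: "(x, j, w) \<notin> E" for j w using g(5) by (auto simp: gch_def)
  have "(u, j, v) \<in> pullE x (pushE x E) \<longleftrightarrow> (u, j, v) \<in> E" for u j v
    unfolding pullE_def 1 using g 2 by (auto simp: pushE_def)
  then show ?thesis by auto
qed

end

text \<open>A pull substitutes the grand parent of \<open>x\<close> for \<open>x\<close> as a source
  of edges. If \<open>x\<close> and \<open>y\<close> are nested, either order sends the edges of the
  lower one to the grand parent of the upper one; otherwise the substitutions are
  independent.\<close>

lemma pullE_commute:
  assumes A: "arbo E" and "x \<in> old_inner E" "y \<in> old_inner E"
  shows "pullE x (pullE y E) = pullE y (pullE x E)"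
proof (cases "x = y")
  case False
  obtain g where g: "\<And>h. x \<in> gch E h \<longleftrightarrow> h = g" "g < x"
    using assms(2) arbo_fun[OF A] arbo_less[OF A] unfolding old_inner_def by blast
  obtain h where h: "\<And>h'. y \<in> gch E h' \<longleftrightarrow> h' = h" "h < y"
    using assms(3) arbo_fun[OF A] arbo_less[OF A] unfolding old_inner_def by blast
  have "(u, j, v) \<in> pullE x (pullE y E) \<longleftrightarrow> (u, j, v) \<in> pullE y (pullE x E)" for u j v
    using False g h unfolding pullE_def[of _ "pullE _ _"] gch_pullE
    by (auto simp: pullE_def)
  then show ?thesis by auto
qed simp


lemma flipE_old: "x \<in> old_inner E \<Longrightarrow> flipE x E = pullE x E"
  by (simp add: flipE_def)

lemma flipE_young: "x \<in> young_outer E \<Longrightarrow> flipE x E = pushE x E"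
  using young_outer_not_old_inner by (auto simp: flipE_def)

lemma flipE_old_facts:
  assumes "arbo E" "x \<in> old_inner E"
  shows "arbo (flipE x E)" "inner (flipE x E) = inner E - {x}"
    "old_inner (flipE x E) = old_inner E - {x}"
    "young_outer (flipE x E) = insert x (young_outer E)"
    "flipE x (flipE x E) = E"
  using assms arbo_pullE inner_pullE old_inner_pullE young_outer_pullE pushE_pullE
  by (simp_all add: flipE_old flipE_young)

lemma flipE_young_facts:
  assumes A: "arbo E" "x \<in> young_outer E"
  shows "arbo (flipE x E)" "inner (flipE x E) = insert x (inner E)"
    "old_inner (flipE x E) = insert x (old_inner E)"
    "young_outer (flipE x E) = young_outer E - {x}"
    "flipE x (flipE x E) = E"
proof -
  show B: "arbo (flipE x E)" and "inner (flipE x E) = insert x (inner E)"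
    using assms arbo_pushE inner_pushE by (simp_all add: flipE_young)
  have o: "x \<in> old_inner (flipE x E)" using assms old_inner_pushE by (simp add: flipE_young)
  show inv: "flipE x (flipE x E) = E" using flipE_old[OF o] pullE_pushE assms by (simp add: flipE_young)
  \<comment> \<open>The effect of a push on the two status sets is read off backwards from the pull
    that undoes it.\<close>
  show "old_inner (flipE x E) = insert x (old_inner E)"
    "young_outer (flipE x E) = young_outer E - {x}"
    using flipE_old_facts(3,4)[OF B o] o young_outer_not_old_inner inv by auto
qed

lemma flipE_commute:
  assumes "arbo E" "x \<in> old_inner E" "y \<in> old_inner E" "x \<noteq> y"
  shows "flipE x (flipE y E) = flipE y (flipE x E)"
  using assms pullE_commute flipE_old old_inner_pullE by auto

text \<open>A flip at \<open>x\<close> is local: it changes only edges leaving \<open>x\<close> or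
  leaving the grand parent of \<open>x\<close>.\<close>

lemma flipE_edges_at:
  assumes "x \<notin> gch E u" "x \<noteq> u"
  shows "(u, j, v) \<in> flipE x E \<longleftrightarrow> (u, j, v) \<in> E"
  using assms by (auto simp: flipE_def pullE_def pushE_def)

text \<open>Each flip changes the status of its own label only, so the labels still to come remain
  old internal. Single flips being involutions, the composition is undone in reverse order, which
  explains \<open>rev\<close> in the last conjunct.\<close>

lemma fold_flipE_old:
  assumes "arbo E" "distinct xs" "set xs \<subseteq> old_inner E"
  shows "arbo (fold flipE xs E) \<and> inner (fold flipE xs E) = inner E - set xs \<and>
    old_inner (fold flipE xs E) = old_inner E - set xs \<and>
    young_outer (fold flipE xs E) = young_outer E \<union> set xs \<and>
    fold flipE (rev xs) (fold flipE xs E) = E"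
  using assms
proof (induction xs arbitrary: E)
  case (Cons x xs)
  then have p: "arbo E" "x \<in> old_inner E" by auto
  note x = flipE_old_facts[OF p]
  have "set xs \<subseteq> old_inner (flipE x E)" using Cons.prems x by auto
  from Cons.IH[OF x(1) _ this] Cons.prems show ?case by (simp add: x) blast
qed simp

lemma fold_flipE_young:
  assumes "arbo E" "distinct xs" "set xs \<subseteq> young_outer E"
  shows "arbo (fold flipE xs E) \<and> inner (fold flipE xs E) = inner E \<union> set xs \<and>
    old_inner (fold flipE xs E) = old_inner E \<union> set xs \<and>
    young_outer (fold flipE xs E) = young_outer E - set xs \<and>
    fold flipE (rev xs) (fold flipE xs E) = E"
  using assms
proof (induction xs arbitrary: E)
  case (Cons x xs)
  then have p: "arbo E" "x \<in> young_outer E" by auto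
  note x = flipE_young_facts[OF p]
  have "set xs \<subseteq> young_outer (flipE x E)" using Cons.prems x by auto
  from Cons.IH[OF x(1) _ this] Cons.prems show ?case by (simp add: x) blast
qed simp

lemma flipE_fold_flipE:
  assumes "arbo E" "distinct (x # xs)" "set (x # xs) \<subseteq> old_inner E"
  shows "flipE x (fold flipE xs E) = fold flipE xs (flipE x E)"
  using assms
proof (induction xs arbitrary: E)
  case (Cons y xs)
  then have "flipE x (fold flipE xs (flipE y E)) = fold flipE xs (flipE x (flipE y E))"
    using flipE_old_facts[of E y] by (intro Cons.IH) auto
  then show ?case using flipE_commute[of E x y] Cons.prems by simp
qed simp

lemma fold_flipE_rev:
  assumes "arbo E" "distinct xs" "set xs \<subseteq> old_inner E"
  shows "fold flipE (rev xs) E = fold flipE xs E"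
  using assms
proof (induction xs)
  case (Cons x xs)
  then show ?case using flipE_fold_flipE[of E x xs] by simp
qed simp

section \<open>Composite flips over a set of labels, taken in the order that \<open>Phi_tree\<close>
  uses\<close>

definition flips :: "nat set \<Rightarrow> edge_set \<Rightarrow> edge_set" where
  "flips S E = fold flipE (sorted_list_of_set S) E"

lemma flips_old:
  assumes "arbo E" "finite S" "S \<subseteq> old_inner E"
  shows "arbo (flips S E)" "inner (flips S E) = inner E - S"
    "old_inner (flips S E) = old_inner E - S"
    "young_outer (flips S E) = young_outer E \<union> S"
    "flips S (flips S E) = E"
proof -
  let ?xs = "sorted_list_of_set S"
  have xs: "distinct ?xs" "set ?xs \<subseteq> old_inner E" using assms by auto
  note f = fold_flipE_old[OF assms(1) xs]
  show "arbo (flips S E)" "inner (flips S E) = inner E - S"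
    "old_inner (flips S E) = old_inner E - S" "young_outer (flips S E) = young_outer E \<union> S"
    using f assms(2) by (simp_all add: flips_def)
  \<comment> \<open>The reversed list is used for the first pass, so that the second pass runs in
    increasing order; commutation of pulls then restores the order of the first pass.\<close>
  have "fold flipE (rev (rev ?xs)) (fold flipE (rev ?xs) E) = E"
    using fold_flipE_old[of E "rev ?xs"] assms(1) xs by simp
  then show "flips S (flips S E) = E"
    using fold_flipE_rev[OF assms(1) xs] by (simp add: flips_def)
qed

lemma flips_young:
  assumes "arbo E" "finite S" "S \<subseteq> young_outer E"
  shows "arbo (flips S E)" "inner (flips S E) = inner E \<union> S"
    "old_inner (flips S E) = old_inner E \<union> S"
    "young_outer (flips S E) = young_outer E - S"
    "flips S (flips S E) = E"
proof -
  let ?xs = "sorted_list_of_set S"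
  have xs: "distinct ?xs" "set ?xs \<subseteq> young_outer E" using assms by auto
  note f = fold_flipE_young[OF assms(1) xs]
  show A: "arbo (flips S E)" and "inner (flips S E) = inner E \<union> S"
    and o: "old_inner (flips S E) = old_inner E \<union> S"
    and "young_outer (flips S E) = young_outer E - S"
    using f assms(2) by (simp_all add: flips_def)
  \<comment> \<open>The undoing pass consists of pulls, because \<open>S\<close> is old internal in
    \<open>flips S E\<close>. Reversing that pass is therefore covered by the commutation of
    pulls.\<close>
  have "fold flipE (rev ?xs) (flips S E) = E" using f by (simp add: flips_def)
  then show "flips S (flips S E) = E"
    using fold_flipE_rev[OF A xs(1)] o assms(2) by (simp add: flips_def)
qed

lemma flips_edges_at:
  assumes "finite S" "S \<inter> gch E u = {}" "u \<notin> S"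
  shows "(u, j, v) \<in> flips S E \<longleftrightarrow> (u, j, v) \<in> E"
proof -
  have "(u, j, v) \<in> fold flipE xs E \<longleftrightarrow> (u, j, v) \<in> E"
    if "set xs \<inter> gch E u = {}" "u \<notin> set xs" for xs j v
    using that
  proof (induction xs arbitrary: E)
    case (Cons x xs)
    then have "\<And>j v. (u, j, v) \<in> flipE x E \<longleftrightarrow> (u, j, v) \<in> E" by (intro flipE_edges_at) auto
    moreover from this have "gch (flipE x E) u = gch E u" by (simp add: gch_def)
    ultimately show ?case using Cons.prems Cons.IH[of "flipE x E"] by simp
  qed simp
  then show ?thesis using assms by (simp add: flips_def)
qed

lemma flips_gch_at:
  assumes "finite S" "S \<inter> gch E u = {}" "u \<notin> S"
  shows "gch (flips S E) u = gch E u"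
  using flips_edges_at[OF assms] by (simp add: gch_def)

text \<open>A pull takes edges away from the pulled node only; every other node can at most gain
  grand children.\<close>

lemma gch_subset_flips:
  assumes "arbo E" "finite S" "S \<subseteq> old_inner E" "u \<notin> S"
  shows "gch E u \<subseteq> gch (flips S E) u"
proof -
  have "gch E u \<subseteq> gch (fold flipE xs E) u"
    if "arbo E" "distinct xs" "set xs \<subseteq> old_inner E" "u \<notin> set xs" for xs
    using that
  proof (induction xs arbitrary: E)
    case (Cons x xs)
    then have "gch E u \<subseteq> gch (flipE x E) u" by (auto simp: flipE_old gch_pullE)
    also have "\<dots> \<subseteq> gch (fold flipE xs (flipE x E)) u"
      using Cons.prems flipE_old_facts[of E x] by (intro Cons.IH) auto
    finally show ?case by simp
  qed simp
  then show ?thesis using assms by (simp add: flips_def)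
qed

section \<open>Removable leaves read off from edges and root labels\<close>

definition first_empty :: "nat \<Rightarrow> edge_set \<Rightarrow> nat \<Rightarrow> bool" where
  "first_empty k E u \<longleftrightarrow> (\<forall>j<k - 1. \<forall>v. (u, j, v) \<notin> E)"

definition rem_old :: "nat \<Rightarrow> nat list \<Rightarrow> edge_set \<Rightarrow> nat set" where
  "rem_old k rs E = {x. \<exists>i<length rs. x \<in> gch E (rs ! i) \<and> (\<forall>w\<in>gch E (rs ! i). w \<le> x) \<and>
     x \<notin> inner E \<and> (\<forall>w\<in>gch E (rs ! i). w \<notin> inner E \<longrightarrow> w = x) \<and>
     first_empty k E (rs ! i) \<and> (Suc i < length rs \<longrightarrow> x < rs ! Suc i)}"

lemma rem_old_flips:
  assumes A: "arbo E" and S: "finite S" "S \<subseteq> old_inner E" and rs: "set rs \<inter> S = {}"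
  shows "rem_old k rs (flips S E) = rem_old k rs E"
proof -
  let ?E = "flips S E"
  note f = flips_old[OF A S]
  have same: "gch ?E u = gch E u" "first_empty k ?E u = first_empty k E u"
    "gch E u \<inter> inner ?E = gch E u \<inter> inner E"
    if "S \<inter> gch E u = {}" "u \<in> set rs" for u
  proof -
    have "u \<notin> S" using that(2) rs by blast
    then show "gch ?E u = gch E u" "first_empty k ?E u = first_empty k E u"
      using flips_gch_at[OF S(1) that(1)] flips_edges_at[OF S(1) that(1)]
      by (simp_all add: first_empty_def)
    show "gch E u \<inter> inner ?E = gch E u \<inter> inner E" using that(1) f(2) by blast
  qed
  \<comment> \<open>Before the flips: an element of \<open>S\<close> below \<open>u\<close> would be
    the greatest grand child of \<open>u\<close>, hence equal to \<open>x\<close>, although it is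
    internal and \<open>x\<close> is not.\<close>
  have disj: "S \<inter> gch E u = {}"
    if "u \<in> set rs" "x \<in> gch E u" "\<forall>w\<in>gch E u. w \<le> x" "x \<notin> inner E" for u x
  proof (rule ccontr)
    assume "S \<inter> gch E u \<noteq> {}"
    then obtain s where s: "s \<in> S" "s \<in> gch E u" by blast
    obtain h where h: "s \<in> gch E h" "\<forall>w\<in>gch E h. w \<le> s" "s \<in> inner E"
      using s(1) S(2) by (auto simp: old_inner_def)
    have "h = u" using arbo_fun[OF A h(1) s(2)] .
    then have "s = x" using h(2) that(2,3) s(2) by (simp add: le_antisym)
    then show False using h(3) that(4) by simp
  qed
  \<comment> \<open>After the flips: an element \<open>s\<close> of \<open>S\<close> is still below
    \<open>u\<close>, as \<open>u\<close> is not flipped. It is now a leaf, so uniqueness gives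
    \<open>s = x\<close>, but being young it is not the greatest one.\<close>
  have disj': "S \<inter> gch E u = {}"
    if "u \<in> set rs" "x \<in> gch ?E u" "\<forall>w\<in>gch ?E u. w \<le> x"
      "\<forall>w\<in>gch ?E u. w \<notin> inner ?E \<longrightarrow> w = x" for u x
  proof (rule ccontr)
    assume "S \<inter> gch E u \<noteq> {}"
    then obtain s where s: "s \<in> S" "s \<in> gch E u" by blast
    then have "s \<in> gch ?E u" using gch_subset_flips[OF A S, of u] that(1) rs by blast
    then have "s = x" using that(4) f(2) s(1) by auto
    moreover have "s \<in> young_outer ?E" using s f(4) by auto
    ultimately obtain h w where "x \<in> gch ?E h" "w \<in> gch ?E h" "x < w"
      by (auto simp: young_outer_def)
    then show False using that(3) arbo_fun[OF f(1) that(2)] by fastforce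
  qed
  show ?thesis unfolding rem_old_def
  proof (rule Collect_cong, rule ex_cong1, rule conj_cong[OF refl])
    fix x i assume i: "i < length rs"
    let ?u = "rs ! i"
    have u: "?u \<in> set rs" using i by simp
    show "(x \<in> gch ?E ?u \<and> (\<forall>w\<in>gch ?E ?u. w \<le> x) \<and> x \<notin> inner ?E \<and>
        (\<forall>w\<in>gch ?E ?u. w \<notin> inner ?E \<longrightarrow> w = x) \<and> first_empty k ?E ?u \<and>
        (Suc i < length rs \<longrightarrow> x < rs ! Suc i)) \<longleftrightarrow>
      (x \<in> gch E ?u \<and> (\<forall>w\<in>gch E ?u. w \<le> x) \<and> x \<notin> inner E \<and>
        (\<forall>w\<in>gch E ?u. w \<notin> inner E \<longrightarrow> w = x) \<and> first_empty k E ?u \<and>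
        (Suc i < length rs \<longrightarrow> x < rs ! Suc i))"
    proof (cases "S \<inter> gch E ?u = {}")
      case True
      have "w \<in> inner ?E \<longleftrightarrow> w \<in> inner E" if "w \<in> gch E ?u" for w
        using same(3)[OF True u] that by blast
      then show ?thesis unfolding same(1,2)[OF True u] by blast
    next
      case False
      then show ?thesis using disj[OF u] disj'[OF u] by blast
    qed
  qed
qed

section \<open>Edge sets of forests\<close>

text \<open>Replaces the doubly nested recursion: what hangs below a root is the forest
  \<open>concat cs\<close>, so facts about forests apply inside a tree.\<close>

lemma nodes_Node: "nodes (Node y cs) = Node y cs # fnodes (concat cs)"
  unfolding fnodes_def nodes.simps by (induction cs) auto

declare nodes.simps [simp del]

lemma fnodes_simps [simp]:
  "fnodes [] = []" "fnodes (T # F) = nodes T @ fnodes F" "fnodes (F @ G) = fnodes F @ fnodes G"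
  by (simp_all add: fnodes_def)

lemma set_fnodes: "set (fnodes F) = (\<Union>T\<in>set F. set (nodes T))"
  by (auto simp: fnodes_def)

lemma self_in_nodes: "T \<in> set (nodes T)"
  by (cases T) (simp add: nodes_Node)

lemma concat_labels: "concat (map labels F) = map label (fnodes F)"
  by (induction F) (auto simp: labels_def)

text \<open>Each labeled node is counted once, either as a root or below its grand parent. Keeping
  multiplicities lets distinct labels yield unique grand parents and separate roots from grand
  children.\<close>

lemma mset_fnodes:
  "mset (fnodes F) = mset F + mset (concat (map gchildren (fnodes F)))"
proof -
  have *: "mset (fnodes G) = mset G + mset (concat (map gchildren (fnodes G)))"
    if "\<And>T. T \<in> set G \<Longrightarrow> mset (nodes T) = {#T#} + mset (concat (map gchildren (nodes T)))" for G
    using that by (induction G) auto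
  have "mset (nodes T) = {#T#} + mset (concat (map gchildren (nodes T)))" for T
  proof (induction T)
    case (Node y cs)
    have "mset (fnodes (concat cs)) =
      mset (concat cs) + mset (concat (map gchildren (fnodes (concat cs))))"
      by (rule *) (use Node in auto)
    moreover have "gchildren (Node y cs) = concat cs" by (simp add: gchildren_def)
    ultimately show ?case by (simp add: nodes_Node)
  qed
  then show ?thesis by (rule *)
qed

lemma set_fnodes_eq: "set (fnodes F) = set F \<union> (\<Union>u\<in>set (fnodes F). set (gchildren u))"
  using arg_cong[OF mset_fnodes[of F], of set_mset] by simp

lemma gchildren_in_fnodes: "u \<in> set (fnodes F) \<Longrightarrow> v \<in> set (gchildren u) \<Longrightarrow> v \<in> set (fnodes F)"
  using set_fnodes_eq[of F] by blast

lemma set_gchildren: "v \<in> set (gchildren u) \<longleftrightarrow> (\<exists>j<length (kids u). v \<in> set (kids u ! j))"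
  unfolding gchildren_def set_concat set_conv_nth[of "kids u"] by blast

definition proper_node :: "nat \<Rightarrow> tree \<Rightarrow> bool" where
  "proper_node k u \<longleftrightarrow> (kids u = [] \<or> length (kids u) = k \<and> gchildren u \<noteq> []) \<and>
     (\<forall>v\<in>set (gchildren u). label u < label v) \<and>
     (\<forall>c\<in>set (kids u). sorted_wrt (<) (map label c))"

text \<open>Nothing is asked of the label set or of the order of the roots. The forest
  \<open>concat cs\<close> below a root therefore inherits properness, as the structural inductions
  require.\<close>

definition proper :: "nat \<Rightarrow> forest \<Rightarrow> bool" where
  "proper k F \<longleftrightarrow> (\<forall>u\<in>set (fnodes F). proper_node k u) \<and> distinct (map label (fnodes F))"

definition edges :: "forest \<Rightarrow> edge_set" where
  "edges F = {(label u, j, label v) | u j v.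
     u \<in> set (fnodes F) \<and> j < length (kids u) \<and> v \<in> set (kids u ! j)}"

lemma distinct_map_concat_nth:
  assumes "distinct (map f (concat xss))" "i < length xss" "j < length xss"
    "a \<in> set (xss ! i)" "b \<in> set (xss ! j)" "f a = f b"
  shows "i = j \<and> a = b"
proof -
  have "i = j" using assms
  proof (induction xss arbitrary: i j)
    case (Cons xs xss)
    have d: "f c \<noteq> f e" if "c \<in> set xs" "e \<in> set (xss ! m)" "m < length xss" for c e m
    proof -
      have "e \<in> set (concat xss)" using that(2,3) by auto
      then have "f e \<in> f ` set (concat xss)" "f c \<in> f ` set xs" using that(1) by blast+
      moreover have "f ` set xs \<inter> f ` set (concat xss) = {}"
        using Cons.prems(1) by (simp del: set_concat)
      ultimately show ?thesis by (metis disjoint_iff)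
    qed
    have dx: "distinct (map f (concat xss))" using Cons.prems(1) by simp
    show ?case
    proof (cases i)
      case 0
      then show ?thesis using Cons.prems(2-) d[of a b] by (cases j) auto
    next
      case (Suc i')
      show ?thesis
      proof (cases j)
        case 0
        then show ?thesis using Cons.prems(2-) d[of b a i'] Suc by simp
      next
        case (Suc j')
        then show ?thesis using Cons.IH[OF dx, of i' j'] Cons.prems(2-) \<open>i = Suc i'\<close> by simp
      qed
    qed
  qed simp
  moreover have "a = b"
  proof -
    have "a \<in> set (concat xss)" "b \<in> set (concat xss)" using assms(2-5) by auto
    moreover have "inj_on f (set (concat xss))" using assms(1) by (simp only: distinct_map)
    ultimately show ?thesis using assms(6) by (meson inj_onD)
  qed
  ultimately show ?thesis by simp
qed

lemma distinct_roots_gchildren: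
  assumes "distinct (map label (fnodes F))"
  shows "distinct (map label (F @ concat (map gchildren (fnodes F))))"
proof -
  have "mset (map label (fnodes F)) = mset (map label (F @ concat (map gchildren (fnodes F))))"
    by (subst mset_map, subst mset_fnodes, simp)
  then show ?thesis using assms mset_eq_imp_distinct_iff by blast
qed

lemma distinct_gchildren:
  assumes "distinct (map label (fnodes F))" "u \<in> set (fnodes F)"
  shows "distinct (map label (concat (kids u)))"
proof -
  obtain A B where "fnodes F = A @ u # B" using assms(2) by (auto dest: split_list)
  then show ?thesis
    using distinct_roots_gchildren[OF assms(1)] by (simp add: gchildren_def del: set_concat)
qed

context
  fixes k F assumes P: "proper k F"
begin

lemma proper_distinct: "distinct (map label (fnodes F))"
  using P by (simp add: proper_def)

lemma node_unique: "u \<in> set (fnodes F) \<Longrightarrow> u' \<in> set (fnodes F) \<Longrightarrow> label u = label u' \<Longrightarrow> u = u'"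
  using P by (auto simp: proper_def distinct_map dest: inj_onD)

lemma gparent_unique:
  assumes "u \<in> set (fnodes F)" "u' \<in> set (fnodes F)" "j < length (kids u)" "j' < length (kids u')"
    "v \<in> set (kids u ! j)" "v' \<in> set (kids u' ! j')" "label v = label v'"
  shows "u = u' \<and> j = j' \<and> v = v'"
proof -
  obtain m m' where m: "m < length (fnodes F)" "fnodes F ! m = u" "m' < length (fnodes F)" "fnodes F ! m' = u'"
    using assms(1,2) by (auto simp: in_set_conv_nth)
  have vu: "v \<in> set (gchildren u)" "v' \<in> set (gchildren u')" using assms(3-6) by (auto simp: set_gchildren)
  have d: "distinct (map label (concat (map gchildren (fnodes F))))"
    using distinct_roots_gchildren[OF proper_distinct] by simp
  have "m = m' \<and> v = v'"
    by (rule distinct_map_concat_nth[OF d]) (use m vu assms(7) in auto)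
  moreover have "j = j'" if "u = u'"
    using distinct_map_concat_nth[OF distinct_gchildren[OF proper_distinct assms(1)], of j j' v v']
      assms that by auto
  ultimately show ?thesis using m by auto
qed

lemma root_not_gchild:
  assumes "T \<in> set F" "u \<in> set (fnodes F)" "v \<in> set (gchildren u)"
  shows "label T \<noteq> label v"
  using distinct_roots_gchildren[OF proper_distinct] assms by force

lemma arbo_edges: "arbo (edges F)"
  unfolding arbo_def
proof (intro conjI allI impI)
  fix u j v assume "(u, j, v) \<in> edges F"
  then show "u < v" using P by (force simp: edges_def proper_def proper_node_def set_gchildren)
next
  fix u j v u' j' assume "(u, j, v) \<in> edges F" "(u', j', v) \<in> edges F"
  then obtain U V U' V' where "U \<in> set (fnodes F)" "U' \<in> set (fnodes F)" "j < length (kids U)"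
    "j' < length (kids U')" "V \<in> set (kids U ! j)" "V' \<in> set (kids U' ! j')" "label V = label V'"
    "u = label U" "u' = label U'"
    by (auto simp: edges_def)
  then show "u = u'" "j = j'" using gparent_unique[of U U' j j' V V'] by simp_all
qed

lemma edges_at:
  assumes "u \<in> set (fnodes F)"
  shows "(label u, j, w) \<in> edges F \<longleftrightarrow> j < length (kids u) \<and> w \<in> label ` set (kids u ! j)"
  using assms node_unique by (fastforce simp: edges_def)

lemma gch_edges:
  assumes "u \<in> set (fnodes F)"
  shows "gch (edges F) (label u) = label ` set (gchildren u)"
  unfolding gch_def edges_at[OF assms] by (force simp: set_gchildren)

lemma inner_edges_iff:
  assumes "u \<in> set (fnodes F)"
  shows "label u \<in> inner (edges F) \<longleftrightarrow> \<not> leaf u"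
proof -
  \<comment> \<open>This is where pruning enters: an internal node has at least one grand child, so
    it is visible as the source of an edge.\<close>
  have "gchildren u = [] \<longleftrightarrow> kids u = []"
    using P assms by (auto simp: proper_def proper_node_def gchildren_def)
  then show ?thesis by (simp add: inner_iff_gch gch_edges[OF assms] leaf_def)
qed

end

text \<open>Whether a node is internal is visible from its edges, and then its number of children is
  \<open>k\<close>, even if some of them are empty lists. Each child list is fixed by its label set
  because it is strictly increasing; induction compares the subtrees.\<close>

lemma edges_determine_node:
  assumes P: "proper k F" "proper k F'" "edges F = edges F'"
  shows "u \<in> set (fnodes F) \<Longrightarrow> u' \<in> set (fnodes F') \<Longrightarrow> label u = label u' \<Longrightarrow> u = u'"
proof (induction u arbitrary: u')
  case (Node y cs)
  let ?u = "Node y cs"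
  obtain cs' where u': "u' = Node y cs'" using Node.prems by (cases u') auto
  have pn: "proper_node k ?u" "proper_node k u'" using P Node.prems by (auto simp: proper_def)
  have E: "j < length cs \<and> w \<in> label ` set (cs ! j) \<longleftrightarrow> j < length cs' \<and> w \<in> label ` set (cs' ! j)" for j w
    using edges_at[OF P(1) Node.prems(1), of j w] edges_at[OF P(2) Node.prems(2), of j w] P(3) u' by simp
  have "cs = [] \<longleftrightarrow> cs' = []"
  proof -
    have "label ` set (gchildren ?u) = label ` set (gchildren u')"
      using gch_edges[OF P(1) Node.prems(1)] gch_edges[OF P(2) Node.prems(2)] P(3) Node.prems(3) by simp
    then show ?thesis using pn u' by (auto simp: proper_node_def gchildren_def)
  qed
  then have len: "length cs = length cs'" using pn u' by (auto simp: proper_node_def)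
  have "cs ! j = cs' ! j" if j: "j < length cs" for j
  proof -
    have "sorted_wrt (<) (map label (cs ! j))" "sorted_wrt (<) (map label (cs' ! j))"
      using pn j len u' by (auto simp: proper_node_def)
    moreover have "set (map label (cs ! j)) = set (map label (cs' ! j))"
      using E[of j] j len by auto
    ultimately have ml: "map label (cs ! j) = map label (cs' ! j)"
      by (simp add: strict_sorted_equal)
    show ?thesis
    proof (rule nth_equalityI)
      show l: "length (cs ! j) = length (cs' ! j)" using ml map_eq_imp_length_eq by blast
      fix i assume i: "i < length (cs ! j)"
      have g: "cs ! j ! i \<in> set (gchildren ?u)" "cs' ! j ! i \<in> set (gchildren u')"
        using i j l len u' unfolding set_gchildren by auto
      show "cs ! j ! i = cs' ! j ! i"
      proof (rule Node.IH)
        show "cs ! j \<in> set cs" "cs ! j ! i \<in> set (cs ! j)" using i j by auto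
        show "cs ! j ! i \<in> set (fnodes F)" "cs' ! j ! i \<in> set (fnodes F')"
          using g gchildren_in_fnodes Node.prems by blast+
        show "label (cs ! j ! i) = label (cs' ! j ! i)" using ml i l by (metis nth_map)
      qed
    qed
  qed
  then show ?case using len u' by (simp add: nth_equalityI)
qed

lemma edges_determine_forest:
  assumes "proper k F" "proper k F'" "edges F = edges F'" "map label F = map label F'"
  shows "F = F'"
proof (rule nth_equalityI)
  show l: "length F = length F'" using assms(4) map_eq_imp_length_eq by blast
  fix i assume i: "i < length F"
  have "F ! i \<in> set (fnodes F)" "F' ! i \<in> set (fnodes F')"
    using i l set_fnodes_eq by (metis UnI1 nth_mem)+
  then show "F ! i = F' ! i"
    using edges_determine_node[OF assms(1-3)] assms(4) i l by (metis nth_map)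
qed

section \<open>A local description of pruned even \<open>k\<close>-ary trees\<close>

fun unprune :: "nat \<Rightarrow> tree \<Rightarrow> tree" where
  "unprune k (Node x cs) =
     Node x (if cs = [] then replicate k [] else map (map (unprune k)) cs)"

text \<open>A witness for the converse is \<open>unprune k T\<close>, which gives every labeled leaf
  \<open>k\<close> childless children. Pruning removes just these, since every other labeled node
  has a grand child.\<close>

lemma pruned_even_kary_iff:
  "pruned_even_kary k T \<longleftrightarrow>
     (\<forall>u\<in>set (nodes T). kids u = [] \<or> length (kids u) = k \<and> gchildren u \<noteq> [])"
proof
  assume "pruned_even_kary k T"
  then obtain T' where T': "even_kary k T'" "T = prune T'" by (auto simp: pruned_even_kary_def)
  have "even_kary k T' \<Longrightarrow>
    \<forall>u\<in>set (nodes (prune T')). kids u = [] \<or> length (kids u) = k \<and> gchildren u \<noteq> []"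
  proof (induction T')
    case (Node y cs)
    have "even_kary k t" if "c \<in> set cs" "t \<in> set c" for c t
      using Node.prems that by (auto simp: even_kary_def nodes_Node set_fnodes)
    then have IH: "\<forall>u\<in>set (nodes (prune t)). kids u = [] \<or> length (kids u) = k \<and> gchildren u \<noteq> []"
      if "c \<in> set cs" "t \<in> set c" for c t using Node.IH that by blast
    have len: "length cs = k" using Node.prems by (simp add: even_kary_def nodes_Node)
    show ?case
    proof (cases "\<forall>c\<in>set cs. c = []")
      case False
      then have "concat (map (map prune) cs) \<noteq> []" by auto
      then show ?thesis using False IH len
        by (simp add: nodes_Node set_fnodes gchildren_def del: concat_eq_Nil_conv)
    qed (simp add: nodes_Node)
  qed
  then show "\<forall>u\<in>set (nodes T). kids u = [] \<or> length (kids u) = k \<and> gchildren u \<noteq> []"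
    using T' by blast
next
  assume "\<forall>u\<in>set (nodes T). kids u = [] \<or> length (kids u) = k \<and> gchildren u \<noteq> []"
  then have "even_kary k (unprune k T) \<and> prune (unprune k T) = T"
  proof (induction T)
    case (Node y cs)
    have IH: "even_kary k (unprune k t) \<and> prune (unprune k t) = t" if "c \<in> set cs" "t \<in> set c" for c t
      by (rule Node.IH[OF that]) (use Node.prems that in \<open>auto simp: nodes_Node set_fnodes\<close>)
    have n: "cs = [] \<or> length cs = k \<and> concat cs \<noteq> []"
      using Node.prems by (auto simp: nodes_Node gchildren_def)
    have "map (map (prune \<circ> unprune k)) cs = cs"
    proof (intro map_idI)
      fix c t assume "c \<in> set cs" "t \<in> set c"
      then show "(prune \<circ> unprune k) t = t" using IH by simp
    qed
    then show ?case
    proof (cases "cs = []")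
      case False
      then have "prune (unprune k (Node y cs)) = Node y cs"
        using n \<open>map (map (prune \<circ> unprune k)) cs = cs\<close> by auto
      moreover have "even_kary k (unprune k (Node y cs))"
        using False IH n by (fastforce simp: even_kary_def nodes_Node set_fnodes)
      ultimately show ?thesis by blast
    qed (auto simp: even_kary_def nodes_Node set_fnodes)
  qed
  then show "pruned_even_kary k T" unfolding pruned_even_kary_def by metis
qed

lemma forests_iff:
  "F \<in> forests n k \<longleftrightarrow>
     proper k F \<and> set (map label (fnodes F)) = {1..n} \<and> sorted_wrt (<) (map label F)"
proof -
  have "(\<forall>T\<in>set F. \<exists>M. inc_tree k M T) \<longleftrightarrow> (\<forall>u\<in>set (fnodes F). proper_node k u)"
    if d: "distinct (map label (fnodes F))"
  proof -
    have "distinct (labels T)" if "T \<in> set F" for T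
      using d that by (auto simp: concat_labels[symmetric] distinct_concat_iff)
    then show ?thesis
      by (fastforce simp: inc_tree_def pruned_even_kary_iff increasing_def proper_node_def set_fnodes)
  qed
  then show ?thesis unfolding forests_def concat_labels proper_def mem_Collect_eq by blast
qed

section \<open>Action of a single flip on forests\<close>

text \<open>The status of \<open>x\<close> and its move depend only on the edges at \<open>x\<close>
  and on those leaving its grand parent. The hypothesis says that \<open>R\<close> contains none of
  them.\<close>

lemma flipE_Un_local:
  assumes "\<And>u j v. (u, j, v) \<in> R \<Longrightarrow> u \<noteq> x \<and> v \<noteq> x \<and> x \<notin> gch B u"
  shows "flipE x (R \<union> B) = R \<union> flipE x B"
proof -
  have 1: "x \<in> gch (R \<union> B) u \<longleftrightarrow> x \<in> gch B u" for u using assms by (auto simp: gch_def)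
  have 2: "gch (R \<union> B) g = gch B g" if "x \<in> gch B g" for g using assms that by (force simp: gch_def)
  have 3: "x \<in> inner (R \<union> B) \<longleftrightarrow> x \<in> inner B" using assms unfolding inner_def by blast
  have "x \<in> old_inner (R \<union> B) \<longleftrightarrow> x \<in> old_inner B" unfolding old_inner_def mem_Collect_eq 1 3
    using 2 by auto
  moreover have "x \<in> young_outer (R \<union> B) \<longleftrightarrow> x \<in> young_outer B"
    unfolding young_outer_def mem_Collect_eq 1 3 using 2 by auto
  moreover have "pullE x (R \<union> B) = R \<union> pullE x B"
    unfolding pullE_def 1 using assms by blast
  moreover have "pushE x (R \<union> B) = R \<union> pushE x B"
    unfolding pushE_def 1 using assms by blast
  ultimately show ?thesis by (simp add: flipE_def)
qed

lemma flipE_idle: "(\<And>u. x \<notin> gch E u) \<Longrightarrow> flipE x E = E"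
  by (auto simp: flipE_def old_inner_def young_outer_def)

lemma flipE_Un:
  assumes A: "\<And>u j v. (u, j, v) \<in> A \<Longrightarrow> u \<in> L \<and> v \<in> L"
    and B: "\<And>u j v. (u, j, v) \<in> B \<Longrightarrow> u \<in> M \<and> v \<in> M" and "L \<inter> M = {}"
  shows "flipE x (A \<union> B) = flipE x A \<union> flipE x B"
proof (cases "x \<in> L")
  case True
  then have "x \<notin> M" using assms(3) by blast
  have "flipE x (B \<union> A) = B \<union> flipE x A"
    by (rule flipE_Un_local) (use A B \<open>x \<notin> M\<close> assms(3) in \<open>unfold gch_def, blast\<close>)
  moreover have "flipE x B = B"
    by (rule flipE_idle) (use B \<open>x \<notin> M\<close> in \<open>auto simp: gch_def\<close>)
  ultimately show ?thesis by (simp add: Un_commute)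
next
  case False
  have "flipE x (A \<union> B) = A \<union> flipE x B"
    by (rule flipE_Un_local) (use A B False assms(3) in \<open>unfold gch_def, blast\<close>)
  moreover have "flipE x A = A"
    by (rule flipE_idle) (use A False in \<open>auto simp: gch_def\<close>)
  ultimately show ?thesis by simp
qed

lemma mset_fnodes_cong: "mset F = mset G \<Longrightarrow> mset (fnodes F) = mset (fnodes G)"
proof -
  have "mset (fnodes F) = (\<Sum>T\<in>#mset F. mset (nodes T))" for F by (induction F) auto
  then show "mset F = mset G \<Longrightarrow> ?thesis" by simp
qed

lemma edges_append: "edges (F @ G) = edges F \<union> edges G"
  by (auto simp: edges_def)

lemma edges_Cons: "edges (T # F) = edges [T] \<union> edges F"
  using edges_append[of "[T]" F] by simp

lemma edges_Nil [simp]: "edges [] = {}"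
  by (simp add: edges_def)

lemma edges_cong_mset: "mset F = mset G \<Longrightarrow> edges F = edges G"
  using mset_eq_setD[OF mset_fnodes_cong, of F G] by (simp add: edges_def)

lemma edges_labels:
  assumes "(u, j, v) \<in> edges F"
  shows "u \<in> label ` set (fnodes F) \<and> v \<in> label ` set (fnodes F)"
proof -
  obtain U V where UV: "U \<in> set (fnodes F)" "j < length (kids U)" "V \<in> set (kids U ! j)"
    "u = label U" "v = label V" using assms by (auto simp: edges_def)
  then have "V \<in> set (fnodes F)" using gchildren_in_fnodes set_gchildren by blast
  then show ?thesis using UV by blast
qed

lemma in_concat_nth: "j < length cs \<Longrightarrow> t \<in> set (cs ! j) \<Longrightarrow> t \<in> set (concat cs)"
  by auto

definition root_edges :: "nat \<Rightarrow> tree list list \<Rightarrow> edge_set" where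
  "root_edges y cs = {(y, j, l) | j l. j < length cs \<and> l \<in> label ` set (cs ! j)}"

lemma edges_Node: "edges [Node y cs] = root_edges y cs \<union> edges (concat cs)"
proof -
  have "root_edges y cs = {(label u, j, label v) | u j v.
      u = Node y cs \<and> j < length (kids u) \<and> v \<in> set (kids u ! j)}"
    by (auto simp: root_edges_def)
  moreover have "set (fnodes [Node y cs]) = {Node y cs} \<union> set (fnodes (concat cs))"
    by (simp add: nodes_Node)
  ultimately show ?thesis unfolding edges_def by blast
qed

lemma proper_Cons:
  "proper k (T # F) \<longleftrightarrow> proper k [T] \<and> proper k F \<and>
     label ` set (nodes T) \<inter> label ` set (fnodes F) = {}"
  by (auto simp: proper_def)

lemma proper_Node:
  "proper k [Node y cs] \<longleftrightarrow> proper_node k (Node y cs) \<and> proper k (concat cs) \<and>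
     y \<notin> label ` set (fnodes (concat cs))"
  by (auto simp: proper_def nodes_Node)

lemma old_inner_edges_iff:
  assumes P: "proper k F" and u: "u \<in> set (fnodes F)" "v \<in> set (gchildren u)"
  shows "label v \<in> old_inner (edges F) \<longleftrightarrow> old u v \<and> \<not> leaf v"
    and "label v \<in> young_outer (edges F) \<longleftrightarrow> young u v \<and> leaf v"
proof -
  have v: "v \<in> set (fnodes F)" using gchildren_in_fnodes u by blast
  have "label v \<in> gch (edges F) (label u)" using gch_edges[OF P u(1)] u(2) by simp
  then have g: "label v \<in> gch (edges F) h \<longleftrightarrow> h = label u" for h
    using arbo_fun[OF arbo_edges[OF P]] by blast
  show "label v \<in> old_inner (edges F) \<longleftrightarrow> old u v \<and> \<not> leaf v"
    unfolding old_inner_def mem_Collect_eq g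
    by (simp add: gch_edges[OF P u(1)] inner_edges_iff[OF P v] old_def u(2))
  show "label v \<in> young_outer (edges F) \<longleftrightarrow> young u v \<and> leaf v"
    unfolding young_outer_def mem_Collect_eq g
    by (auto simp: gch_edges[OF P u(1)] inner_edges_iff[OF P v] young_def old_def u(2) not_le)
qed

text \<open>The invariant of the induction over trees. Labels are compared as multisets so that
  distinctness carries over to the new forest.\<close>

definition flipped :: "nat \<Rightarrow> nat \<Rightarrow> forest \<Rightarrow> forest \<Rightarrow> bool" where
  "flipped k x F F' \<longleftrightarrow> proper k F' \<and>
     mset (map label (fnodes F')) = mset (map label (fnodes F)) \<and> edges F' = flipE x (edges F)"

lemma label_Phi1 [simp]: "label (Phi1 x T) = label T"
  by (cases T) (auto split: option.split)

lemma flipped_labels: "flipped k x F F' \<Longrightarrow> label ` set (fnodes F') = label ` set (fnodes F)"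
  unfolding flipped_def by (metis mset_eq_setD set_map)

text \<open>The trees of a proper forest have disjoint label sets, so a flip of the union of their
  edge sets splits into flips of the parts.\<close>

lemma flipped_map_Phi1:
  assumes "\<And>t. t \<in> set G \<Longrightarrow> proper k [t] \<Longrightarrow> flipped k x [t] [Phi1 x t]" "proper k G"
  shows "flipped k x G (map (Phi1 x) G)"
  using assms
proof (induction G)
  case Nil
  then show ?case by (simp add: flipped_def flipE_idle gch_def)
next
  case (Cons t G)
  have p: "proper k [t]" "proper k G" "label ` set (nodes t) \<inter> label ` set (fnodes G) = {}"
    using Cons.prems(2) unfolding proper_Cons[of k t G] by auto
  have 1: "flipped k x [t] [Phi1 x t]" and 2: "flipped k x G (map (Phi1 x) G)"
    using Cons p by auto
  have "proper k (Phi1 x t # map (Phi1 x) G)"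
    unfolding proper_Cons[of k "Phi1 x t" "map (Phi1 x) G"]
    using 1 2 p(3) flipped_labels[OF 1] flipped_labels[OF 2] by (simp add: flipped_def)
  moreover have "edges (Phi1 x t # map (Phi1 x) G) = flipE x (edges (t # G))"
  proof -
    have "flipE x (edges [t] \<union> edges G) = flipE x (edges [t]) \<union> flipE x (edges G)"
      using p(3) edges_labels[of _ _ _ "[t]"] edges_labels[of _ _ _ G]
      by (intro flipE_Un[where L = "label ` set (nodes t)" and M = "label ` set (fnodes G)"]) auto
    then show ?thesis using 1 2 by (simp add: flipped_def edges_Cons[of "Phi1 x t" "map (Phi1 x) G"]
      edges_Cons[of t G])
  qed
  ultimately show ?case using 1 2 by (simp add: flipped_def)
qed

lemma flipped_below:
  assumes P: "proper k [Node y cs]" and F: "flipped k x (concat cs) (map (Phi1 x) (concat cs))"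
    and x: "\<And>v. v \<in> set (concat cs) \<Longrightarrow> label v \<noteq> x"
  shows "flipped k x [Node y cs] [Node y (map (map (Phi1 x)) cs)]"
proof -
  have p: "proper_node k (Node y cs)" "proper k (concat cs)" "y \<notin> label ` set (fnodes (concat cs))"
    using P by (auto simp: proper_Node)
  have c: "concat (map (map (Phi1 x)) cs) = map (Phi1 x) (concat cs)" by (simp add: map_concat)
  have "proper_node k (Node y (map (map (Phi1 x)) cs))"
    using p(1) unfolding proper_node_def gchildren_def tree.sel c by (auto simp: o_def)
  then have "proper k [Node y (map (map (Phi1 x)) cs)]"
    using F p(3) flipped_labels[OF F] by (simp add: proper_Node c flipped_def)
  moreover have "mset (map label (fnodes [Node y (map (map (Phi1 x)) cs)])) = mset (map label (fnodes [Node y cs]))"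
    using F by (simp add: nodes_Node c flipped_def)
  moreover have "edges [Node y (map (map (Phi1 x)) cs)] = flipE x (edges [Node y cs])"
  proof -
    have "root_edges y (map (map (Phi1 x)) cs) = root_edges y cs"
      by (auto simp: root_edges_def image_image)
    moreover have "flipE x (root_edges y cs \<union> edges (concat cs)) = root_edges y cs \<union> flipE x (edges (concat cs))"
    \<comment> \<open>If \<open>x\<close> labels the root, the root edges do leave \<open>x\<close>
      and locality fails; but then no edge enters \<open>x\<close> and every flip involved is
      idle.\<close>
    proof (cases "x = y")
      case True
      have "v \<noteq> y" if "(u, j, v) \<in> edges [Node y cs]" for u j v
      proof
        assume "v = y"
        then have "(u, j, v) \<in> root_edges y cs"
          using that p(3) edges_labels[of u j v "concat cs"] by (auto simp: edges_Node)
        then obtain t where "j < length cs" "t \<in> set (cs ! j)" "label t = x"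
          using \<open>v = y\<close> True by (auto simp: root_edges_def)
        then show False using x[OF in_concat_nth] by blast
      qed
      then show ?thesis using True
        by (subst flipE_idle, force simp: edges_Node gch_def)+ simp
    next
      case False
      show ?thesis
      proof (rule flipE_Un_local)
        fix u j v assume "(u, j, v) \<in> root_edges y cs"
        then show "u \<noteq> x \<and> v \<noteq> x \<and> x \<notin> gch (edges (concat cs)) u"
        proof -
          obtain t where "u = y" "j < length cs" "t \<in> set (cs ! j)" "label t = v"
            using \<open>(u, j, v) \<in> root_edges y cs\<close> by (auto simp: root_edges_def)
          moreover from this have "v \<noteq> x" using x[OF in_concat_nth] by blast
          ultimately show ?thesis
            using False p(3) edges_labels[of y _ x "concat cs"] by (auto simp: gch_def)
        qed
      qed
    qed
    ultimately show ?thesis using F by (simp add: edges_Node c flipped_def)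
  qed
  ultimately show ?thesis by (simp add: flipped_def)
qed

lemma sort_key_label_sorted:
  "distinct (map label c) \<Longrightarrow> sorted_wrt (<) (map label (sort_key label c))"
  by (simp add: strict_sorted_iff distinct_map)

lemma root_edges_iff:
  "(u, j, l) \<in> root_edges y cs \<longleftrightarrow> u = y \<and> j < length cs \<and> l \<in> label ` set (cs ! j)"
  by (auto simp: root_edges_def)

lemma sources_edges:
  assumes "x \<notin> label ` set (fnodes F)"
  shows "(x, j, v) \<notin> edges F"
  using assms edges_labels by blast

text \<open>With \<open>concat cs = A @ v # B\<close>, the subtrees below the root become
  \<open>A\<close>, the bare node \<open>x\<close>, \<open>B\<close> and the former subtrees of
  \<open>v\<close>. All nodes but the root and \<open>x\<close> are unchanged, so only these two
  need a check.\<close>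

lemma flipped_pull:
  assumes P: "proper k [Node y cs]" and v: "v \<in> set (concat cs)" "label v = x"
    and o: "old (Node y cs) v" "\<not> leaf v"
  shows "flipped k x [Node y cs] [Node y (pull x cs (kids v))]"
proof -
  let ?T = "Node y cs" and ?ns = "kids v"
  let ?T' = "Node y (pull x cs ?ns)"
  define rep where "rep t = (if label t = x then Node x [] else t)" for t
  have p: "proper_node k ?T" "proper k (concat cs)" "y \<notin> label ` set (fnodes (concat cs))"
    using P by (auto simp: proper_Node)
  obtain A B where AB: "concat cs = A @ v # B" using v(1) by (meson split_list)
  have nv: "nodes v = v # fnodes (concat ?ns)" by (cases v) (simp add: nodes_Node)
  have ev: "edges [v] = root_edges x ?ns \<union> edges (concat ?ns)" using v(2) by (cases v) (simp add: edges_Node)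
  have d: "distinct (map label (fnodes A @ v # fnodes (concat ?ns) @ fnodes B))"
    using p(2) by (simp add: proper_def AB nv)
  have xn: "x \<notin> label ` set (fnodes A)" "x \<notin> label ` set (fnodes B)" "x \<notin> label ` set (fnodes (concat ?ns))"
    using d v(2) by auto
  have pv: "proper_node k v" using p(2) by (simp add: proper_def AB nv)
  have len: "length cs = k" "length ?ns = k"
    using p(1) pv v(1) o(2) by (auto simp: proper_node_def leaf_def)
  have rl: "label (rep t) = label t" for t by (simp add: rep_def)
  have repid: "map rep D = D" if "x \<notin> label ` set (fnodes D)" for D
  proof (rule map_idI)
    fix t assume "t \<in> set D"
    then have "t \<in> set (fnodes D)" using set_fnodes_eq by blast
    then show "rep t = t" using that by (auto simp: rep_def)
  qed
  have repG: "map rep (concat cs) = A @ Node x [] # B"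
    using repid xn v(2) by (simp add: AB rep_def[of v])
  have nth: "set (pull x cs ?ns ! j) = rep ` set (cs ! j) \<union> set (?ns ! j)" if "j < k" for j
    using that len by (simp add: pull_def rep_def)
  have lenp: "length (pull x cs ?ns) = k" using len by (simp add: pull_def)
  \<comment> \<open>For what lies below the root, neither sorting nor grouping matters: nodes and
    edges of a forest depend only on its multiset of trees.\<close>
  have mc: "mset (concat (pull x cs ns)) = mset (map rep (concat cs)) + mset (concat ns)"
    if "length cs = length ns" for cs ns
    using that by (induction cs ns rule: list_induct2) (auto simp: pull_def rep_def[abs_def])
  then have mc: "mset (concat (pull x cs ?ns)) = mset (A @ Node x [] # B @ concat ?ns)"
    using len repG by (metis append.assoc append_Cons mset_append)
  have mf: "mset (fnodes (concat (pull x cs ?ns))) =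
      mset (fnodes A @ Node x [] # fnodes B @ fnodes (concat ?ns))"
    using mset_fnodes_cong[OF mc] by (simp add: nodes_Node)
  have ml: "mset (map label (fnodes [?T'])) = mset (map label (fnodes [?T]))"
    using arg_cong[OF mf, of "image_mset label"] v(2) by (simp add: nodes_Node AB nv)
  have d': "distinct (map label (fnodes [?T']))"
    using ml P mset_eq_imp_distinct_iff by (metis proper_def)
  have sf: "set (fnodes (concat (pull x cs ?ns))) =
      set (fnodes A) \<union> {Node x []} \<union> set (fnodes B) \<union> set (fnodes (concat ?ns))"
    using mset_eq_setD[OF mf] by auto
  have sg: "set (concat (pull x cs ?ns)) = set A \<union> {Node x []} \<union> set B \<union> set (concat ?ns)"
    using mset_eq_setD[OF mc] by auto
  have "proper_node k ?T'"
    unfolding proper_node_def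
  proof (intro conjI ballI)
    have "concat (pull x cs ?ns) \<noteq> []" using sg by (metis Un_iff empty_iff empty_set insertI1)
    then show "kids ?T' = [] \<or> length (kids ?T') = k \<and> gchildren ?T' \<noteq> []"
      using lenp unfolding gchildren_def by simp
  next
    fix t assume "t \<in> set (gchildren ?T')"
    then have t: "t \<in> set A \<union> {Node x []} \<union> set B \<union> set (concat ?ns)"
      using sg unfolding gchildren_def tree.sel by blast
    have "y < label t" if "t \<in> set (concat cs)" for t
      using p(1) that unfolding proper_node_def gchildren_def tree.sel by blast
    moreover have "x < label t" if "t \<in> set (concat ?ns)" for t
      using pv that v(2) unfolding proper_node_def gchildren_def tree.sel by blast
    moreover have "set (concat cs) = insert v (set A \<union> set B)" by (simp add: AB del: set_concat)
    moreover have "y < x" using calculation(1)[OF v(1)] v(2) by simp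
    ultimately show "label ?T' < label t"
      using t by (auto intro: less_trans simp del: set_concat)
  next
    fix c assume c: "c \<in> set (kids ?T')"
    then obtain c' where c': "c = sort_key label c'" by (auto simp: pull_def)
    have "distinct (map label (concat (kids ?T')))"
      by (rule distinct_gchildren[OF d']) (simp add: nodes_Node)
    then have "distinct (map label c)" using c by (auto simp: map_concat distinct_concat_iff)
    moreover have "sorted (map label c)" unfolding c' by (rule sorted_sort_key)
    ultimately show "sorted_wrt (<) (map label c)" by (simp add: strict_sorted_iff)
  qed
  moreover have "\<forall>u\<in>set (fnodes A) \<union> set (fnodes B) \<union> set (fnodes (concat ?ns)). proper_node k u"
    using p(2) unfolding proper_def AB by (simp add: nv ball_Un)
  moreover have "proper_node k (Node x [])" by (simp add: proper_node_def gchildren_def)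
  moreover have "set (fnodes [?T']) = insert ?T' (set (fnodes (concat (pull x cs ?ns))))"
    by (simp add: nodes_Node)
  ultimately have "\<forall>u\<in>set (fnodes [?T']). proper_node k u"
    by (simp only: sf ball_Un ball_simps simp_thms)
  then have "proper k [?T']" using d' unfolding proper_def by (rule conjI)
  moreover have "edges [?T'] = flipE x (edges [?T])"
  proof -
    have oi: "x \<in> old_inner (edges [?T])"
      using old_inner_edges_iff(1)[OF P, of ?T v] v o by (simp add: nodes_Node gchildren_def)
    have gy: "x \<in> gch (edges [?T]) u \<longleftrightarrow> u = y" for u
    proof -
      have "x \<in> gch (edges [?T]) y"
        using gch_edges[OF P, of ?T] v by (auto simp: nodes_Node gchildren_def)
      then show ?thesis using arbo_fun[OF arbo_edges[OF P]] by blast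
    qed
    have E: "edges [?T] = root_edges y cs \<union> edges A \<union> edges B \<union> root_edges x ?ns \<union> edges (concat ?ns)"
      by (simp add: edges_Node AB edges_append edges_Cons[of v B] ev Un_ac)
    have "edges [Node x []] = {}" by (simp add: edges_Node root_edges_def)
    then have "edges (concat (pull x cs ?ns)) = edges A \<union> edges B \<union> edges (concat ?ns)"
      by (simp add: edges_cong_mset[OF mc] edges_append edges_Cons[of "Node x []" "B @ concat ?ns"] Un_ac)
    \<comment> \<open>Both lists have length \<open>k\<close>, so merging them index by index loses
      nothing; on root edges the merge is a union.\<close>
    moreover have "root_edges y (pull x cs ?ns) = root_edges y cs \<union> root_edges y ?ns"
      unfolding root_edges_def using len lenp nth rl by (auto simp: image_Un image_image)
    ultimately have E': "edges [?T'] = root_edges y cs \<union> root_edges y ?ns \<union> edges A \<union> edges B \<union> edges (concat ?ns)"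
      by (simp add: edges_Node Un_ac)
    have xy: "x \<noteq> y" using p(3) v(2) by (auto simp: AB nv)
    have "(u, j, w) \<in> edges [?T'] \<longleftrightarrow> (u, j, w) \<in> pullE x (edges [?T])" for u j w
    proof -
      have 1: "(x, j, w) \<in> edges [?T] \<longleftrightarrow> (y, j, w) \<in> root_edges y ?ns"
        using sources_edges[OF xn(1)] sources_edges[OF xn(2)] sources_edges[OF xn(3)] xy
        unfolding E by (auto simp: root_edges_def)
      have 2: "u \<noteq> x \<and> (u, j, w) \<in> edges [?T] \<longleftrightarrow>
          (u, j, w) \<in> root_edges y cs \<union> edges A \<union> edges B \<union> edges (concat ?ns)"
        using sources_edges[OF xn(1)] sources_edges[OF xn(2)] sources_edges[OF xn(3)] xy
        unfolding E by (auto simp: root_edges_def)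
      have 3: "(u, j, w) \<in> root_edges y ?ns \<longleftrightarrow> u = y \<and> (y, j, w) \<in> root_edges y ?ns"
        by (auto simp: root_edges_def)
      show ?thesis unfolding pullE_def mem_Collect_eq prod.case gy 1 2 E' using 3 by blast
    qed
    then show ?thesis unfolding flipE_old[OF oi] by auto
  qed
  ultimately show ?thesis using ml by (simp add: flipped_def)
qed

lemma flipped_push:
  assumes P: "proper k [Node y cs]" and v: "v \<in> set (concat cs)" "label v = x"
    and o: "young (Node y cs) v" "leaf v"
  shows "flipped k x [Node y cs] [Node y (push x cs)]"
proof -
  let ?T = "Node y cs"
  let ?T' = "Node y (push x cs)"
  let ?hi = "\<lambda>s. x < label s" and ?lo = "\<lambda>s. \<not> x < label s"
  define ns where "ns = map (\<lambda>m. sort_key label (filter ?hi m)) cs"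
  define rep where "rep t = (if label t = x then Node x ns else t)" for t
  have p: "proper_node k ?T" "proper k (concat cs)" "y \<notin> label ` set (fnodes (concat cs))"
    using P by (auto simp: proper_Node)
  obtain A B where AB: "concat cs = A @ v # B" using v(1) by (meson split_list)
  have v0: "v = Node x []" using o(2) v(2) by (cases v) (simp add: leaf_def)
  have nv: "nodes v = [v]" by (simp add: v0 nodes_Node)
  have d: "distinct (map label (fnodes A @ v # fnodes B))"
    using p(2) by (simp add: proper_def AB nv)
  have xn: "x \<notin> label ` set (fnodes A)" "x \<notin> label ` set (fnodes B)"
    using d v(2) by auto
  have len: "length cs = k" using p(1) v(1) by (auto simp: proper_node_def)
  have rl: "label (rep t) = label t" for t by (simp add: rep_def)
  have repid: "map rep (filter Q D) = filter Q D" if "x \<notin> label ` set (fnodes D)" for D Q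
  proof (rule map_idI)
    fix t assume "t \<in> set (filter Q D)"
    then have "t \<in> set (fnodes D)" using set_fnodes_eq by auto
    then show "rep t = t" using that by (auto simp: rep_def)
  qed
  have pushrep: "push x cs = map (\<lambda>m. map rep (filter ?lo m)) cs"
    by (simp add: push_def rep_def[abs_def] ns_def)
  \<comment> \<open>The node \<open>x\<close> survives the filter because \<open>x < x\<close>
    fails, and it is the only tree that \<open>rep\<close> alters.\<close>
  have cpush: "concat (push x cs) = filter ?lo A @ Node x ns # filter ?lo B"
  proof -
    have "concat (push x cs) = map rep (filter ?lo (concat cs))"
      by (simp add: pushrep map_concat filter_concat o_def)
    then show ?thesis using repid[OF xn(1)] repid[OF xn(2)] v(2) by (simp add: AB rep_def[of v])
  qed
  have cns: "mset (concat ns) = mset (filter ?hi A @ filter ?hi B)"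
  proof -
    have "mset (concat ns) = mset (filter ?hi (concat cs))"
      unfolding ns_def by (induction cs) auto
    then show ?thesis using v(2) by (simp add: AB)
  qed
  \<comment> \<open>The trees with root label above \<open>x\<close> now hang below
    \<open>x\<close>; together with those that stayed they give back all nodes, and likewise all
    edges.\<close>
  have part: "mset (fnodes (filter ?hi D)) + mset (fnodes (filter ?lo D)) = mset (fnodes D)" for D
  proof -
    have "mset (filter ?hi D @ filter ?lo D) = mset D" by (simp add: multiset_partition[symmetric])
    from mset_fnodes_cong[OF this] show ?thesis by simp
  qed
  have parte: "edges (filter ?hi D) \<union> edges (filter ?lo D) = edges D" for D
  proof -
    have "mset (filter ?hi D @ filter ?lo D) = mset D" by (simp add: multiset_partition[symmetric])
    from edges_cong_mset[OF this] show ?thesis by (simp add: edges_append)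
  qed
  have mf: "mset (fnodes (concat (push x cs))) = mset (fnodes A @ Node x ns # fnodes B)"
    using mset_fnodes_cong[OF cns] part[of A] part[of B]
    by (simp add: cpush nodes_Node) (metis (no_types, lifting) union_assoc union_commute)
  have ml: "mset (map label (fnodes [?T'])) = mset (map label (fnodes [?T]))"
    using arg_cong[OF mf, of "image_mset label"] v(2) by (simp add: nodes_Node AB nv)
  have d': "distinct (map label (fnodes [?T']))"
    using ml P mset_eq_imp_distinct_iff by (metis proper_def)
  have sf: "set (fnodes (concat (push x cs))) = set (fnodes A) \<union> {Node x ns} \<union> set (fnodes B)"
    using mset_eq_setD[OF mf] by auto
  have ycs: "y < label t" if "t \<in> set (concat cs)" for t
    using p(1) that unfolding proper_node_def gchildren_def tree.sel by blast
  have srt: "sorted_wrt (<) (map label c)" if "c \<in> set cs" for c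
    using p(1) that by (simp add: proper_node_def)
  have "proper_node k ?T'"
    unfolding proper_node_def
  proof (intro conjI ballI)
    show "kids ?T' = [] \<or> length (kids ?T') = k \<and> gchildren ?T' \<noteq> []"
      using len unfolding gchildren_def tree.sel cpush by (simp add: push_def)
  next
    fix t assume "t \<in> set (gchildren ?T')"
    then show "label ?T' < label t"
      using ycs v unfolding gchildren_def tree.sel cpush by (auto simp: AB simp del: set_concat)
  next
    fix c assume c: "c \<in> set (kids ?T')"
    then obtain m where m: "m \<in> set cs" "c = map rep (filter ?lo m)" by (auto simp: pushrep)
    have "map label c = map label (filter ?lo m)" by (simp add: m rl)
    then show "sorted_wrt (<) (map label c)"
      using srt[OF m(1)] by (simp add: sorted_wrt_map sorted_wrt_filter)
  qed
  moreover have "proper_node k (Node x ns)"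
    unfolding proper_node_def
  proof (intro conjI ballI)
    \<comment> \<open>Being young supplies a companion \<open>b\<close> with a greater label, so the
      \<open>k\<close> new children of \<open>x\<close> are not all empty and the tree stays
      pruned.\<close>
    obtain b where "b \<in> set (concat cs)" "x < label b"
      using o(1) v by (auto simp: young_def old_def gchildren_def not_le)
    then have "b \<in> set (filter ?hi A @ filter ?hi B)" using v(2) by (auto simp: AB simp del: set_concat)
    then have "concat ns \<noteq> []" using mset_eq_setD[OF cns] by (metis empty_iff empty_set)
    then show "kids (Node x ns) = [] \<or> length (kids (Node x ns)) = k \<and> gchildren (Node x ns) \<noteq> []"
      using len unfolding gchildren_def tree.sel by (simp add: ns_def)
  next
    fix t assume "t \<in> set (gchildren (Node x ns))"
    then show "label (Node x ns) < label t"
      by (auto simp: gchildren_def ns_def)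
  next
    fix c assume c: "c \<in> set (kids (Node x ns))"
    then obtain m where m: "m \<in> set cs" "c = sort_key label (filter ?hi m)" by (auto simp: ns_def)
    have "distinct (map label m)" using srt[OF m(1)] by (simp add: strict_sorted_iff)
    then have "distinct (map label (filter ?hi m))" by (rule distinct_map_filter)
    then show "sorted_wrt (<) (map label c)" unfolding m(2) by (rule sort_key_label_sorted)
  qed
  moreover have "\<forall>u\<in>set (fnodes A) \<union> set (fnodes B). proper_node k u"
    using p(2) unfolding proper_def AB by (simp add: ball_Un)
  moreover have "set (fnodes [?T']) = insert ?T' (set (fnodes (concat (push x cs))))"
    by (simp add: nodes_Node)
  ultimately have "\<forall>u\<in>set (fnodes [?T']). proper_node k u"
    by (simp only: sf ball_Un ball_simps simp_thms)
  then have "proper k [?T']" using d' unfolding proper_def by (rule conjI)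
  moreover have "edges [?T'] = flipE x (edges [?T])"
  proof -
    have yo: "x \<in> young_outer (edges [?T])"
      using old_inner_edges_iff(2)[OF P, of ?T v] v o by (simp add: nodes_Node gchildren_def)
    have gy: "x \<in> gch (edges [?T]) u \<longleftrightarrow> u = y" for u
    proof -
      have "x \<in> gch (edges [?T]) y"
        using gch_edges[OF P, of ?T] v by (auto simp: nodes_Node gchildren_def)
      then show ?thesis using arbo_fun[OF arbo_edges[OF P]] by blast
    qed
    have "edges [v] = {}" by (simp add: v0 edges_Node root_edges_def)
    then have E: "edges [?T] = root_edges y cs \<union> edges A \<union> edges B"
      by (simp add: edges_Node AB edges_append edges_Cons[of v B] Un_ac)
    have "edges (concat (push x cs)) = edges (filter ?lo A) \<union> (root_edges x ns \<union>
        (edges (filter ?hi A) \<union> edges (filter ?hi B)) \<union> edges (filter ?lo B))"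
      unfolding cpush edges_append edges_Cons[of "Node x ns" "filter ?lo B"] edges_Node
        edges_cong_mset[OF cns] ..
    also have "\<dots> = root_edges x ns \<union> edges A \<union> edges B"
      using parte[of A] parte[of B] by blast
    finally have E': "edges [?T'] = root_edges y (push x cs) \<union> root_edges x ns \<union> edges A \<union> edges B"
      by (simp add: edges_Node Un_ac)
    have ri: "label ` set (map rep (filter ?lo m)) = {l \<in> label ` set m. \<not> x < l}" for m
      by (auto simp: rl image_image)
    have r1: "(u, j, w) \<in> root_edges y (push x cs) \<longleftrightarrow> (u, j, w) \<in> root_edges y cs \<and> \<not> x < w" for u j w
      by (cases "j < length cs") (auto simp: root_edges_iff pushrep ri simp del: set_map)
    have r2: "(u, j, w) \<in> root_edges x ns \<longleftrightarrow> u = x \<and> x < w \<and> (y, j, w) \<in> root_edges y cs" for u j w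
      by (cases "j < length cs") (auto simp: root_edges_iff ns_def)
    have yn: "y \<notin> label ` set (fnodes A)" "y \<notin> label ` set (fnodes B)" using p(3) by (auto simp: AB)
    have "(u, j, w) \<in> edges [?T'] \<longleftrightarrow> (u, j, w) \<in> pushE x (edges [?T])" for u j w
    proof -
      have 1: "(y, j, w) \<in> edges [?T] \<longleftrightarrow> (y, j, w) \<in> root_edges y cs"
        using sources_edges[OF yn(1)] sources_edges[OF yn(2)] unfolding E by blast
      have 2: "(u, j, w) \<in> edges [?T] \<and> \<not> (u = y \<and> x < w) \<longleftrightarrow>
          (u, j, w) \<in> root_edges y cs \<and> \<not> x < w \<or> (u, j, w) \<in> edges A \<or> (u, j, w) \<in> edges B"
        using sources_edges[OF yn(1)] sources_edges[OF yn(2)]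
        unfolding E by (auto simp: root_edges_def)
      show ?thesis unfolding pushE_def mem_Collect_eq prod.case gy 2 E' Un_iff r1 r2 using 1 by blast
    qed
    then show ?thesis unfolding flipE_young[OF yo] by auto
  qed
  ultimately show ?thesis using ml by (simp add: flipped_def)
qed

lemma flipped_Phi1_tree: "proper k [T] \<Longrightarrow> flipped k x [T] [Phi1 x T]"
proof (induction T)
  case (Node y cs)
  show ?case
  proof (cases "find (\<lambda>v. label v = x) (concat cs)")
    case None
    have "flipped k x (concat cs) (map (Phi1 x) (concat cs))"
      by (rule flipped_map_Phi1) (use Node in \<open>auto simp: proper_Node\<close>)
    moreover have "label v \<noteq> x" if "v \<in> set (concat cs)" for v
      using None that unfolding find_None_iff by blast
    ultimately show ?thesis using flipped_below[OF Node.prems] None by simp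
  next
    case (Some v)
    then have v: "v \<in> set (concat cs)" "label v = x"
      unfolding find_Some_iff by (auto simp del: set_concat)
    have g: "Node y cs \<in> set (fnodes [Node y cs])" "v \<in> set (gchildren (Node y cs))"
      using v by (simp_all add: nodes_Node gchildren_def)
    note oy = old_inner_edges_iff[OF Node.prems g, unfolded v(2)]
    show ?thesis
    proof (cases "old (Node y cs) v \<and> \<not> leaf v \<or> young (Node y cs) v \<and> leaf v")
      case True
      then show ?thesis using flipped_pull[OF Node.prems v] flipped_push[OF Node.prems v] Some
        by (auto simp: young_def)
    next
      case False
      then have "flipE x (edges [Node y cs]) = edges [Node y cs]" using oy by (auto simp: flipE_def)
      moreover have "Phi1 x (Node y cs) = Node y cs" using False Some by auto
      ultimately show ?thesis using Node.prems by (simp add: flipped_def)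
    qed
  qed
qed

lemma flipped_Phi1: "proper k F \<Longrightarrow> flipped k x F (map (Phi1 x) F)"
  using flipped_map_Phi1 flipped_Phi1_tree by blast

section \<open>Statistics of forests in terms of edge sets\<close>

lemma Phi1_idle: "x \<notin> label ` set (nodes T) \<Longrightarrow> Phi1 x T = T"
proof (induction T)
  case (Node y cs)
  have n: "x \<notin> label ` set (nodes t)" if "c \<in> set cs" "t \<in> set c" for c t
    using Node.prems that by (auto simp: nodes_Node set_fnodes)
  then have "label t \<noteq> x" if "t \<in> set (concat cs)" for t
    using that self_in_nodes[of t] by auto
  then have "find (\<lambda>v. label v = x) (concat cs) = None" unfolding find_None_iff by blast
  moreover have "map (map (Phi1 x)) cs = cs"
  proof (intro map_idI)
    fix c t assume ct: "c \<in> set cs" "t \<in> set c"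
    show "Phi1 x t = t" by (rule Node.IH[OF ct n[OF ct]])
  qed
  ultimately show ?case by simp
qed

lemma fold_Phi1_filter:
  assumes "proper k [T]"
  shows "fold Phi1 (filter (\<lambda>x. x \<in> label ` set (nodes T)) xs) T = fold Phi1 xs T"
  using assms
proof (induction xs arbitrary: T)
  case (Cons x xs)
  have f: "flipped k x [T] [Phi1 x T]" using flipped_Phi1_tree[OF Cons.prems] .
  have "label ` set (nodes (Phi1 x T)) = label ` set (nodes T)"
    using flipped_labels[OF f] by simp
  moreover have "proper k [Phi1 x T]" using f by (simp add: flipped_def)
  ultimately show ?case using Cons.IH[of "Phi1 x T"] Cons.IH[OF Cons.prems] Phi1_idle[of x T] by simp
qed simp

lemma fold_map_Phi1: "fold (\<lambda>x. map (Phi1 x)) xs F = map (fold Phi1 xs) F"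
  by (induction xs arbitrary: F) (simp_all add: o_def)

lemma sorted_list_of_set_Int:
  assumes "finite S"
  shows "sorted_list_of_set (S \<inter> L) = filter (\<lambda>x. x \<in> L) (sorted_list_of_set S)"
proof (rule sorted_distinct_set_unique)
  show "sorted (filter (\<lambda>x. x \<in> L) (sorted_list_of_set S))"
    using sorted_filter[of "\<lambda>x. x" "sorted_list_of_set S"] by simp
qed (use assms in auto)

text \<open>\<open>Phi\<close> restricts \<open>S\<close> to the labels of each tree. Other labels
  act trivially on that tree, so all of \<open>S\<close> may be applied everywhere, and
  \<open>Phi\<close> becomes a composition of forest-wide single flips.\<close>

lemma Phi_eq_fold:
  assumes "proper k F" "finite S"
  shows "Phi S F = fold (\<lambda>x. map (Phi1 x)) (sorted_list_of_set S) F"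
  unfolding Phi_def fold_map_Phi1
proof (rule map_cong[OF refl])
  fix T assume "T \<in> set F"
  then obtain A B where "F = A @ T # B" by (meson split_list)
  then have "proper k [T]" using assms(1) by (auto simp: proper_def)
  from fold_Phi1_filter[OF this, of "sorted_list_of_set S"]
  show "Phi_tree (S \<inter> set (labels T)) T = fold Phi1 (sorted_list_of_set S) T"
    using assms(2) by (simp add: Phi_tree_def labels_def sorted_list_of_set_Int)
qed

lemma proper_Phi:
  assumes "proper k F" "finite S"
  shows "proper k (Phi S F)" "edges (Phi S F) = flips S (edges F)"
    "map label (Phi S F) = map label F"
    "label ` set (fnodes (Phi S F)) = label ` set (fnodes F)"
proof -
  have "proper k (fold (\<lambda>x. map (Phi1 x)) xs F) \<and>
    edges (fold (\<lambda>x. map (Phi1 x)) xs F) = fold flipE xs (edges F) \<and>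
    map label (fold (\<lambda>x. map (Phi1 x)) xs F) = map label F \<and>
    label ` set (fnodes (fold (\<lambda>x. map (Phi1 x)) xs F)) = label ` set (fnodes F)" for xs
    using assms(1)
  proof (induction xs arbitrary: F)
    case (Cons x xs)
    have f: "flipped k x F (map (Phi1 x) F)" using flipped_Phi1[OF Cons.prems] .
    then have "proper k (map (Phi1 x) F)" "edges (map (Phi1 x) F) = flipE x (edges F)"
      by (simp_all add: flipped_def)
    moreover have "map label (map (Phi1 x) F) = map label F" by simp
    ultimately show ?case using Cons.IH[of "map (Phi1 x) F"] flipped_labels[OF f] by simp
  qed simp
  then show "proper k (Phi S F)" "edges (Phi S F) = flips S (edges F)"
    "map label (Phi S F) = map label F"
    "label ` set (fnodes (Phi S F)) = label ` set (fnodes F)"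
    unfolding Phi_eq_fold[OF assms] flips_def by blast+
qed

definition rem_young :: "nat \<Rightarrow> nat \<Rightarrow> edge_set \<Rightarrow> nat set" where
  "rem_young k r E = {x \<in> young_outer E \<inter> gch E r. first_empty k (flipE x E) r}"

lemma gch_edgesE:
  assumes "x \<in> gch (edges F) h"
  obtains u v where "u \<in> set (fnodes F)" "v \<in> set (gchildren u)" "label v = x" "label u = h"
  using assms unfolding gch_def edges_def set_gchildren by blast

lemma root_in_fnodes: "T \<in> set F \<Longrightarrow> T \<in> set (fnodes F)"
  using set_fnodes_eq by blast

lemma gch_labels: "gch (edges F) h \<subseteq> label ` set (fnodes F)"
  using edges_labels by (auto simp: gch_def)

lemma first_leaves_iff:
  assumes "proper k F" "T \<in> set F"
  shows "first_leaves k T \<longleftrightarrow> first_empty k (edges F) (label T)"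
  unfolding first_leaves_def first_empty_def edges_at[OF assms(1) root_in_fnodes[OF assms(2)]]
    all_set_conv_all_nth
  by auto

context
  fixes k F assumes P: "proper k F"
begin

lemma Oint_eq: "Oint F = old_inner (edges F)"
proof
  show "Oint F \<subseteq> old_inner (edges F)"
  proof
    fix x assume "x \<in> Oint F"
    then obtain u v where uv: "u \<in> set (fnodes F)" "old u v" "\<not> leaf v" "x = label v"
      by (auto simp: Oint_def)
    then have "v \<in> set (gchildren u)" by (simp add: old_def)
    from old_inner_edges_iff(1)[OF P uv(1) this] uv show "x \<in> old_inner (edges F)" by simp
  qed
  show "old_inner (edges F) \<subseteq> Oint F"
  proof
    fix x assume x: "x \<in> old_inner (edges F)"
    then obtain h where "x \<in> gch (edges F) h" by (auto simp: old_inner_def)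
    then obtain u v where uv: "u \<in> set (fnodes F)" "v \<in> set (gchildren u)" "label v = x"
      by (rule gch_edgesE)
    from old_inner_edges_iff(1)[OF P uv(1,2)] x uv show "x \<in> Oint F" by (auto simp: Oint_def)
  qed
qed

lemma Yleaf_eq: "Yleaf F = young_outer (edges F)"
proof
  show "Yleaf F \<subseteq> young_outer (edges F)"
  proof
    fix x assume "x \<in> Yleaf F"
    then obtain u v where uv: "u \<in> set (fnodes F)" "young u v" "leaf v" "x = label v"
      by (auto simp: Yleaf_def)
    then have "v \<in> set (gchildren u)" by (simp add: young_def)
    from old_inner_edges_iff(2)[OF P uv(1) this] uv show "x \<in> young_outer (edges F)" by simp
  qed
  show "young_outer (edges F) \<subseteq> Yleaf F"
  proof
    fix x assume x: "x \<in> young_outer (edges F)"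
    then obtain h where "x \<in> gch (edges F) h" by (auto simp: young_outer_def)
    then obtain u v where uv: "u \<in> set (fnodes F)" "v \<in> set (gchildren u)" "label v = x"
      by (rule gch_edgesE)
    from old_inner_edges_iff(2)[OF P uv(1,2)] x uv show "x \<in> Yleaf F" by (auto simp: Yleaf_def)
  qed
qed

lemma root_not_gch:
  assumes "r \<in> set (map label F)" shows "r \<notin> gch (edges F) h"
proof
  assume "r \<in> gch (edges F) h"
  then obtain u v where "u \<in> set (fnodes F)" "v \<in> set (gchildren u)" "label v = r"
    by (rule gch_edgesE)
  moreover obtain T where "T \<in> set F" "label T = r" using assms by auto
  ultimately show False using root_not_gchild[OF P] by blast
qed

text \<open>The last root can be removed unconditionally: if it is internal, it is absent from the
  difference anyway.\<close>

lemma Si_star_eq: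
  assumes "F \<noteq> []"
  shows "Si_star F = set (map label F) - inner (edges F) - {last (map label F)}"
proof -
  have lf: "leaf T \<longleftrightarrow> label T \<notin> inner (edges F)" if "T \<in> set F" for T
    using inner_edges_iff[OF P root_in_fnodes[OF that]] by simp
  have Si: "Si F = set (map label F) - inner (edges F)"
    using lf by (auto simp: Si_def)
  show ?thesis using lf[of "last F"] assms by (auto simp: Si_star_def Si last_map)
qed

lemma Oint_star_eq:
  assumes "F \<noteq> []"
  shows "Oint_star F = old_inner (edges F) - gch (edges F) (last (map label F))"
proof -
  have l: "last F \<in> set (fnodes F)" using assms root_in_fnodes by simp
  have "{label v | v. old (last F) v \<and> \<not> leaf v} = old_inner (edges F) \<inter> gch (edges F) (label (last F))"
    using old_inner_edges_iff(1)[OF P l] unfolding gch_edges[OF P l] by (auto simp: old_def)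
  then show ?thesis using assms by (auto simp: Oint_star_def Oint_eq last_map)
qed

lemma removable_old_eq: "removable_old k F = rem_old k (map label F) (edges F)"
proof -
  let ?E = "edges F"
  have iff: "(\<exists>u. x = label u \<and> old (F ! i) u \<and> leaf u \<and>
        (\<forall>w\<in>set (gchildren (F ! i)). leaf w \<longrightarrow> w = u) \<and> first_leaves k (F ! i) \<and>
        (Suc i < length F \<longrightarrow> label u < label (F ! Suc i))) \<longleftrightarrow>
      x \<in> gch ?E (label (F ! i)) \<and> (\<forall>w\<in>gch ?E (label (F ! i)). w \<le> x) \<and> x \<notin> inner ?E \<and>
        (\<forall>w\<in>gch ?E (label (F ! i)). w \<notin> inner ?E \<longrightarrow> w = x) \<and> first_empty k ?E (label (F ! i)) \<and>
        (Suc i < length F \<longrightarrow> x < label (F ! Suc i))" (is "?L \<longleftrightarrow> ?R") if i: "i < length F" for x i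
  proof -
    let ?u = "F ! i"
    have u: "?u \<in> set F" "?u \<in> set (fnodes F)" using i root_in_fnodes by auto
    have in_f: "w \<in> set (fnodes F)" if "w \<in> set (gchildren ?u)" for w
      using gchildren_in_fnodes u(2) that by blast
    have lf: "label w \<in> inner ?E \<longleftrightarrow> \<not> leaf w" if "w \<in> set (gchildren ?u)" for w
      using inner_edges_iff[OF P in_f[OF that]] .
    have inj: "label w = label u \<longleftrightarrow> w = u" if "w \<in> set (gchildren ?u)" "u \<in> set (gchildren ?u)" for w u
      using node_unique[OF P in_f in_f] that by blast
    show ?thesis
      unfolding gch_edges[OF P u(2)]
    proof
      assume ?L
      then show "x \<in> label ` set (gchildren ?u) \<and> (\<forall>w\<in>label ` set (gchildren ?u). w \<le> x) \<and> x \<notin> inner ?E \<and>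
        (\<forall>w\<in>label ` set (gchildren ?u). w \<notin> inner ?E \<longrightarrow> w = x) \<and> first_empty k ?E (label ?u) \<and>
        (Suc i < length F \<longrightarrow> x < label (F ! Suc i))"
        using lf first_leaves_iff[OF P u(1)] by (auto simp: old_def)
    next
      assume R: "x \<in> label ` set (gchildren ?u) \<and> (\<forall>w\<in>label ` set (gchildren ?u). w \<le> x) \<and> x \<notin> inner ?E \<and>
        (\<forall>w\<in>label ` set (gchildren ?u). w \<notin> inner ?E \<longrightarrow> w = x) \<and> first_empty k ?E (label ?u) \<and>
        (Suc i < length F \<longrightarrow> x < label (F ! Suc i))"
      then obtain u where uu: "u \<in> set (gchildren ?u)" "x = label u" by blast
      have 1: "\<forall>w\<in>set (gchildren ?u). leaf w \<longrightarrow> w = u"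
        using R lf inj[OF _ uu(1)] uu(2) by auto
      have "\<forall>w\<in>label ` set (gchildren ?u). w \<le> x" "x \<notin> inner ?E" using R by blast+
      then have 2: "old ?u u" "leaf u" using uu lf[OF uu(1)] by (simp_all add: old_def)
      have 3: "first_leaves k ?u" using R first_leaves_iff[OF P u(1)] by blast
      have "Suc i < length F \<longrightarrow> x < label (F ! Suc i)" using R by blast
      then have 4: "Suc i < length F \<longrightarrow> label u < label (F ! Suc i)" using uu(2) by simp
      from uu(2) 1 2 3 4 show "\<exists>u. x = label u \<and> old ?u u \<and> leaf u \<and>
        (\<forall>w\<in>set (gchildren ?u). leaf w \<longrightarrow> w = u) \<and> first_leaves k ?u \<and>
        (Suc i < length F \<longrightarrow> label u < label (F ! Suc i))"
        by (intro exI conjI)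
    qed
  qed
  have 1: "x \<in> removable_old k F \<longleftrightarrow> (\<exists>i<length F. \<exists>u. x = label u \<and> old (F ! i) u \<and> leaf u \<and>
        (\<forall>w\<in>set (gchildren (F ! i)). leaf w \<longrightarrow> w = u) \<and> first_leaves k (F ! i) \<and>
        (Suc i < length F \<longrightarrow> label u < label (F ! Suc i)))" for x
    unfolding removable_old_def mem_Collect_eq by blast
  have 2: "x \<in> rem_old k (map label F) ?E \<longleftrightarrow> (\<exists>i<length F. 
      x \<in> gch ?E (label (F ! i)) \<and> (\<forall>w\<in>gch ?E (label (F ! i)). w \<le> x) \<and> x \<notin> inner ?E \<and>
        (\<forall>w\<in>gch ?E (label (F ! i)). w \<notin> inner ?E \<longrightarrow> w = x) \<and> first_empty k ?E (label (F ! i)) \<and>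
        (Suc i < length F \<longrightarrow> x < label (F ! Suc i)))" for x
    unfolding rem_old_def mem_Collect_eq length_map
    by (rule ex_cong1, rule conj_cong[OF refl]) simp
  have "x \<in> removable_old k F \<longleftrightarrow> x \<in> rem_old k (map label F) ?E" for x
    unfolding 1 2 by (rule ex_cong1, rule conj_cong[OF refl], rule iff)
  then show ?thesis by blast
qed

lemma removable_young_eq:
  assumes "F \<noteq> []"
  shows "removable_young k F = rem_young k (last (map label F)) (edges F)"
proof -
  let ?E = "edges F" and ?r = "last F"
  have l: "?r \<in> set F" "?r \<in> set (fnodes F)" using assms root_in_fnodes by simp_all
  \<comment> \<open>Removability of a young leaf refers to the last tree alone; mapping
    \<open>Phi1 x\<close> over the whole forest gives the same last tree and makes the flip of the
    full edge set available.\<close>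
  have fl: "first_leaves k (Phi1 x ?r) \<longleftrightarrow> first_empty k (flipE x ?E) (label ?r)" for x
  proof -
    have "flipped k x F (map (Phi1 x) F)" using flipped_Phi1[OF P] .
    then have p: "proper k (map (Phi1 x) F)" and e: "edges (map (Phi1 x) F) = flipE x ?E"
      by (simp_all add: flipped_def)
    have "Phi1 x ?r \<in> set (map (Phi1 x) F)" using l by simp
    from first_leaves_iff[OF p this] show ?thesis unfolding e by simp
  qed
  have "x \<in> removable_young k F \<longleftrightarrow> x \<in> rem_young k (label ?r) ?E" for x
    using old_inner_edges_iff(2)[OF P l(2)]
    unfolding removable_young_def rem_young_def fl gch_edges[OF P l(2)] by (auto simp: young_def)
  then show ?thesis using assms by (auto simp: last_map)
qed

text \<open>Both sets lie among the finitely many labels, so cardinality zero does mean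
  empty.\<close>

lemma rleaf_zero_iff:
  assumes "F \<noteq> []"
  shows "rleaf k F = 0 \<longleftrightarrow>
    rem_old k (map label F) (edges F) = {} \<and> rem_young k (last (map label F)) (edges F) = {}"
proof -
  have "rem_old k (map label F) (edges F) \<subseteq> label ` set (fnodes F)"
    "rem_young k (last (map label F)) (edges F) \<subseteq> label ` set (fnodes F)"
    using gch_labels by (auto simp: rem_old_def rem_young_def)
  then have "finite (rem_old k (map label F) (edges F))"
    "finite (rem_young k (last (map label F)) (edges F))"
    using finite_subset by blast+
  then show ?thesis
    by (simp add: rleaf_def removable_old_eq removable_young_eq[OF assms])
qed

lemma lleaf_eq: "lleaf F = card (label ` set (fnodes F) - inner (edges F))"
proof -
  have d: "distinct (map label (fnodes F))" using P by (simp add: proper_def)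
  have "lleaf F = card (set (filter leaf (fnodes F)))"
    using d unfolding lleaf_def by (intro distinct_card[symmetric]) (simp add: distinct_map)
  also have "\<dots> = card (label ` set (filter leaf (fnodes F)))"
    using d by (intro card_image[symmetric]) (auto simp: distinct_map intro: inj_on_subset)
  also have "label ` set (filter leaf (fnodes F)) = label ` set (fnodes F) - inner (edges F)"
    using inner_edges_iff[OF P] by auto
  finally show ?thesis .
qed

lemma si_eq: "si F = card (set (map label F) - inner (edges F))"
proof -
  have d: "distinct (map label F)" using distinct_roots_gchildren P by (auto simp: proper_def)
  have "si F = card (set (filter leaf F))"
    using d unfolding si_def by (intro distinct_card[symmetric]) (simp add: distinct_map)
  also have "\<dots> = card (label ` set (filter leaf F))"
    using d by (intro card_image[symmetric]) (auto simp: distinct_map intro: inj_on_subset)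
  also have "label ` set (filter leaf F) = set (map label F) - inner (edges F)"
    using inner_edges_iff[OF P root_in_fnodes] by auto
  finally show ?thesis .
qed

end

section \<open>The bijections\<close>

lemma forests_nonempty: "n \<ge> 1 \<Longrightarrow> F \<in> forests n k \<Longrightarrow> F \<noteq> []"
  by (auto simp: forests_iff)

text \<open>The singleton alternative is absorbed, because a root without children satisfies the
  condition on its first \<open>k - 1\<close> children vacuously.\<close>

lemma forests_bar_iff:
  assumes "n \<ge> 1"
  shows "F \<in> forests_bar n k \<longleftrightarrow>
    F \<in> forests n k \<and> first_empty k (edges F) (last (map label F))"
proof -
  have "leaf (last F) \<or> first_leaves k (last F) \<longleftrightarrow> first_empty k (edges F) (last (map label F))"
    if F: "F \<in> forests n k"
  proof -
    have "F \<noteq> []" "proper k F" using forests_nonempty[OF assms F] F by (simp_all add: forests_iff)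
    then have "first_leaves k (last F) \<longleftrightarrow> first_empty k (edges F) (last (map label F))"
      by (simp add: first_leaves_iff last_map)
    moreover have "leaf (last F) \<Longrightarrow> first_leaves k (last F)"
      by (simp add: leaf_def first_leaves_def)
    ultimately show ?thesis by blast
  qed
  then show ?thesis by (auto simp: forests_bar_def)
qed

lemma X_bar_iff:
  assumes "n \<ge> 1"
  shows "(F, S) \<in> X_bar n k \<longleftrightarrow> F \<in> forests n k \<and>
    first_empty k (edges F) (last (map label F)) \<and> young_outer (edges F) = {} \<and>
    rem_old k (map label F) (edges F) = {} \<and> S \<subseteq> Oint_star F \<union> Si_star F"
proof -
  have "Yleaf F = {} \<and> rleaf k F = 0 \<longleftrightarrow>
    young_outer (edges F) = {} \<and> rem_old k (map label F) (edges F) = {}" if F: "F \<in> forests n k"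
  proof -
    have "F \<noteq> []" "proper k F" using forests_nonempty[OF assms F] F by (simp_all add: forests_iff)
    then show ?thesis by (auto simp: Yleaf_eq rleaf_zero_iff rem_young_def)
  qed
  then show ?thesis using forests_bar_iff[OF assms]
    by (auto simp: X_bar_def forests_bar_star_def)
qed

lemma Y_bar_iff:
  assumes "n \<ge> 1"
  shows "(F, S) \<in> Y_bar n k \<longleftrightarrow> F \<in> forests n k \<and>
    first_empty k (edges F) (last (map label F)) \<and>
    rem_old k (map label F) (edges F) = {} \<and>
    rem_young k (last (map label F)) (edges F) = {} \<and> S \<subseteq> Si_star F"
proof -
  have "rleaf k F = 0 \<longleftrightarrow> rem_old k (map label F) (edges F) = {} \<and>
      rem_young k (last (map label F)) (edges F) = {}" if F: "F \<in> forests n k"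
  proof -
    have "F \<noteq> []" "proper k F" using forests_nonempty[OF assms F] F by (simp_all add: forests_iff)
    then show ?thesis by (rule rleaf_zero_iff[rotated])
  qed
  then show ?thesis using forests_bar_iff[OF assms] by (auto simp: Y_bar_def)
qed

lemma forests_Phi:
  assumes "F \<in> forests n k" "finite S"
  shows "Phi S F \<in> forests n k"
  using assms proper_Phi[of k F S] by (simp add: forests_iff)

text \<open>Flipping twice restores the edges and never touches the root labels, and these data
  determine the forest.\<close>

lemma Phi_cancel:
  assumes P: "proper k F" and S: "finite S" and "flips S (flips S (edges F)) = edges F"
  shows "Phi S (Phi S F) = F"
proof (rule edges_determine_forest)
  note 1 = proper_Phi[OF P S]
  note 2 = proper_Phi[OF 1(1) S]
  show "proper k (Phi S (Phi S F))" "proper k F" by fact+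
  show "edges (Phi S (Phi S F)) = edges F" "map label (Phi S (Phi S F)) = map label F"
    using 1 2 assms(3) by simp_all
qed

lemma Theta_X_bar:
  assumes n: "n \<ge> 1" and X: "(F, S) \<in> X_bar n k"
  defines "S1 \<equiv> S \<inter> Oint_star F"
  shows "Theta (F, S) = (Phi S1 F, S \<inter> Si_star F)"
    and "Theta (F, S) \<in> Y_bar n k"
    and "Theta' (Theta (F, S)) = (F, S)"
    and "lleaf (Phi S1 F) = lleaf F + card S1" and "si (Phi S1 F) = si F"
proof -
  let ?E = "edges F" and ?rs = "map label F"
  let ?r = "last ?rs" and ?F = "Phi S1 F"
  have F: "F \<in> forests n k" and fe: "first_empty k ?E ?r" and y: "young_outer ?E = {}"
    and ro: "rem_old k ?rs ?E = {}" and S: "S \<subseteq> Oint_star F \<union> Si_star F"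
    using X unfolding X_bar_iff[OF n] by auto
  have ne: "F \<noteq> []" and P: "proper k F" using forests_nonempty[OF n F] F by (simp_all add: forests_iff)
  have A: "arbo ?E" using arbo_edges[OF P] .
  have r: "?r \<in> set ?rs" using ne by (simp add: last_map)
  have S1: "S1 \<subseteq> old_inner ?E" "S1 \<inter> gch ?E ?r = {}" unfolding S1_def Oint_star_eq[OF P ne] by blast+
  have S1L: "S1 \<subseteq> label ` set (fnodes F)"
    using S1(1) gch_labels[of F] by (fastforce simp: old_inner_def)
  then have fin: "finite S1" using finite_subset by blast
  have rsO: "set ?rs \<inter> old_inner ?E = {}" using root_not_gch[OF P] by (auto simp: old_inner_def)
  then have rsS: "set ?rs \<inter> S1 = {}" using S1 by blast
  have SiO: "Si_star F \<subseteq> set ?rs" using Si_star_eq[OF P ne] by blast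
  \<comment> \<open>The elements of \<open>S\<close> outside \<open>Oint_star F\<close> label roots,
    and a root is never old. Hence \<open>S\<close> contains no old internal node from below the
    last root.\<close>
  have "S \<inter> Oint F = S1"
    using S SiO rsO unfolding S1_def Oint_eq[OF P] Oint_star_eq[OF P ne] by blast
  then show Th: "Theta (F, S) = (?F, S \<inter> Si_star F)" by (simp add: Theta_def)
  note f = flips_old[OF A fin S1(1)]
  note p = proper_Phi[OF P fin]
  have ne': "?F \<noteq> []" using p(3) ne by auto
  have Si: "Si_star ?F = Si_star F"
    unfolding Si_star_eq[OF P ne] Si_star_eq[OF p(1) ne'] p(2,3) f(2) using rsS by blast
  have rS: "?r \<notin> S1" using r rsS by blast
  note at = flips_edges_at[OF fin S1(2) rS]
  have "first_empty k (edges ?F) ?r" using fe unfolding p(2) first_empty_def at .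
  moreover have "rem_old k ?rs (edges ?F) = {}"
    using ro unfolding p(2) rem_old_flips[OF A fin S1(1) rsS] .
  \<comment> \<open>The young leaves of the new forest are exactly \<open>S1\<close>, and none of
    them lies directly below the last root.\<close>
  moreover have "rem_young k ?r (edges ?F) = {}"
    using S1(2) unfolding rem_young_def p(2) f(4) y flips_gch_at[OF fin S1(2) rS] by blast
  ultimately show "Theta (F, S) \<in> Y_bar n k"
    unfolding Th Y_bar_iff[OF n] p(3) Si using forests_Phi[OF F fin] by blast
  have "Yleaf ?F = S1" unfolding Yleaf_eq[OF p(1)] p(2) f(4) y by simp
  then show "Theta' (Theta (F, S)) = (F, S)"
    unfolding Th using Phi_cancel[OF P fin f(5)] S by (auto simp: Theta'_def S1_def)
  have in1: "S1 \<subseteq> inner ?E" using S1(1) by (auto simp: old_inner_def)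
  \<comment> \<open>The flipped labels are internal before and leaves afterwards, which produces the
    gain \<open>card S1\<close>; roots are not among them, so singletons are unaffected.\<close>
  have "label ` set (fnodes F) - inner (edges ?F) = (label ` set (fnodes F) - inner ?E) \<union> S1"
    unfolding p(2) f(2) using S1L by blast
  then show "lleaf ?F = lleaf F + card S1"
    unfolding lleaf_eq[OF P] lleaf_eq[OF p(1)] p(4)
    using in1 fin by (simp add: card_Un_disjoint Diff_Int_distrib2 disjoint_iff subset_iff)
  have "set ?rs - inner (edges ?F) = set ?rs - inner ?E" unfolding p(2) f(2) using rsS by blast
  then show "si ?F = si F" unfolding si_eq[OF P] si_eq[OF p(1)] p(3) by simp
qed

lemma Theta'_Y_bar:
  assumes n: "n \<ge> 1" and Y: "(F, S) \<in> Y_bar n k"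
  shows "Theta' (F, S) \<in> X_bar n k" and "Theta (Theta' (F, S)) = (F, S)"
proof -
  let ?E = "edges F" and ?rs = "map label F"
  let ?r = "last ?rs" and ?S = "young_outer (edges F)"
  let ?F = "Phi ?S F"
  have F: "F \<in> forests n k" and fe: "first_empty k ?E ?r" and ry: "rem_young k ?r ?E = {}"
    and ro: "rem_old k ?rs ?E = {}" and S: "S \<subseteq> Si_star F"
    using Y unfolding Y_bar_iff[OF n] by auto
  have ne: "F \<noteq> []" and P: "proper k F" using forests_nonempty[OF n F] F by (simp_all add: forests_iff)
  have A: "arbo ?E" using arbo_edges[OF P] .
  have r: "?r \<in> set ?rs" using ne by (simp add: last_map)
  have "?S \<subseteq> label ` set (fnodes F)"
    using gch_labels[of F] by (fastforce simp: young_outer_def)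
  then have fin: "finite ?S" using finite_subset by blast
  have rsS: "set ?rs \<inter> ?S = {}" using root_not_gch[OF P] by (auto simp: young_outer_def)
  have rS: "?r \<notin> ?S" using r rsS by blast
  \<comment> \<open>Only the last child of the last root has children, so a young leaf two levels below that
    root stays inside this child under \<open>Phi1\<close> and would be removable.\<close>
  have Sg: "?S \<inter> gch ?E ?r = {}"
  proof (rule ccontr)
    assume "?S \<inter> gch ?E ?r \<noteq> {}"
    then obtain x where x: "x \<in> ?S" "x \<in> gch ?E ?r" by blast
    then have "x \<noteq> ?r" using rS by blast
    then have "first_empty k (flipE x ?E) ?r"
      using fe unfolding flipE_young[OF x(1)] by (auto simp: first_empty_def pushE_def)
    then show False using ry x by (auto simp: rem_young_def)
  qed
  note f = flips_young[OF A fin subset_refl]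
  note p = proper_Phi[OF P fin]
  have ne': "?F \<noteq> []" using p(3) ne by auto
  have Th: "Theta' (F, S) = (?F, S \<union> ?S)" by (simp add: Theta'_def Yleaf_eq[OF P])
  have Si: "Si_star ?F = Si_star F"
    unfolding Si_star_eq[OF P ne] Si_star_eq[OF p(1) ne'] p(2,3) f(2) using rsS by blast
  have SiO: "Si_star F \<subseteq> set ?rs" using Si_star_eq[OF P ne] by blast
  have S2: "?S \<subseteq> old_inner (flips ?S ?E)" using f(3) by blast
  have "first_empty k (edges ?F) ?r"
    using fe unfolding p(2) first_empty_def flips_edges_at[OF fin Sg rS] .
  moreover have "young_outer (edges ?F) = {}" unfolding p(2) f(4) by simp
  \<comment> \<open>The invariance is applied to the flipped edge set, where the labels are old
    internal and flipping once more leads back to \<open>F\<close>.\<close>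
  moreover have "rem_old k ?rs (edges ?F) = {}"
    using ro rem_old_flips[OF f(1) fin S2 rsS, of k] unfolding p(2) f(5) by simp
  moreover have "?S \<subseteq> Oint_star ?F"
    unfolding Oint_star_eq[OF p(1) ne'] p(2,3) flips_gch_at[OF fin Sg rS] using S2 Sg by blast
  ultimately show "Theta' (F, S) \<in> X_bar n k"
    unfolding Th X_bar_iff[OF n] p(3) Si using forests_Phi[OF F fin] S by blast
  have "set ?rs \<inter> old_inner (edges ?F) = {}"
    using root_not_gch[OF p(1)] unfolding p(3) by (auto simp: old_inner_def)
  \<comment> \<open>The two parts of the union can be told apart: \<open>S\<close> consists of
    roots, the former young leaves are not roots.\<close>
  then have "(S \<union> ?S) \<inter> Oint ?F = ?S"
    using S SiO S2 unfolding Oint_eq[OF p(1)] p(2) by blast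
  moreover have "(S \<union> ?S) \<inter> Si_star ?F = S" using S SiO rsS unfolding Si by blast
  ultimately show "Theta (Theta' (F, S)) = (F, S)"
    unfolding Th using Phi_cancel[OF P fin f(5)] by (simp add: Theta_def)
qed

theorem proposition5p5:
  fixes n k :: nat
  assumes "n \<ge> 1" and "k \<ge> 1"
  shows "bij_betw Theta (X_bar n k) (Y_bar n k) \<and>
    bij_betw Theta' (Y_bar n k) (X_bar n k) \<and>
    (\<forall>p\<in>X_bar n k. Theta' (Theta p) = p) \<and>
    (\<forall>q\<in>Y_bar n k. Theta (Theta' q) = q) \<and>
    (\<forall>F S S1 S2. (F, S) \<in> X_bar n k \<longrightarrow> S1 = S \<inter> Oint_star F \<longrightarrow> S2 = S \<inter> Si_star F \<longrightarrow>
       Theta (F, S) = (Phi S1 F, S2) \<and>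
       int (lleaf (Phi S1 F)) - int (si (Phi S1 F)) = int (lleaf F) - int (si F) + int (card S1))"
proof -
  have X: "Theta p \<in> Y_bar n k" "Theta' (Theta p) = p" if "p \<in> X_bar n k" for p
    using Theta_X_bar(2,3)[OF assms(1)] that by (cases p; blast)+
  have Y: "Theta' q \<in> X_bar n k" "Theta (Theta' q) = q" if "q \<in> Y_bar n k" for q
    using Theta'_Y_bar[OF assms(1)] that by (cases q; blast)+
  have "bij_betw Theta (X_bar n k) (Y_bar n k)"
    by (rule bij_betw_byWitness[where f' = Theta']) (use X Y in blast)+
  moreover have "bij_betw Theta' (Y_bar n k) (X_bar n k)"
    by (rule bij_betw_byWitness[where f' = Theta]) (use X Y in blast)+
  moreover have "Theta (F, S) = (Phi S1 F, S2) \<and>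
       int (lleaf (Phi S1 F)) - int (si (Phi S1 F)) = int (lleaf F) - int (si F) + int (card S1)"
    if "(F, S) \<in> X_bar n k" "S1 = S \<inter> Oint_star F" "S2 = S \<inter> Si_star F" for F S S1 S2
    using Theta_X_bar(1,4,5)[OF assms(1) that(1)] that(2,3) by simp
  ultimately show ?thesis using X Y by blast
qed

end
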